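(* Let $(W,H,\mu)$ be a complex abstract Wiener space, $\mathbf{C}$ a finite dimensional complex inner product space, $\omega:W\times W\to\mathbf{C}$ a continuous skew-symmetric complex bilinear form, and $\mathfrak{g}_{CM}=H\times\mathbf{C}$ the associated Cameron–Martin Lie algebra. Let $T>0$. The finite rank tensors in $J_T^0(\mathfrak{g}_{CM})$, i.e. those $\alpha\in J_T^0(\mathfrak{g}_{CM})$ with $\alpha_n=0$ for all but finitely many $n$, are dense in $J_T^0(\mathfrak{g}_{CM})$.
   Context: Complex abstract Wiener space $(W,H,\mu)$: $W$ is a complex separable Banach space, $W_{\mathrm{Re}}$ is $W$ viewed as a real Banach space, $\mu$ is a Borel probability measure on $W$ with $\int_W e^{iu(w)}d\mu(w)=e^{-q(u,u)/2}$ for all $u\in W_{\mathrm{Re}}^*$, where $q$ is an inner product on $W_{\mathrm{Re}}^*$, and $\mu$ is invariant under $w\mapsto iw$. Put $\|w\|_H:=\sup_{u\in W_{\mathrm{Re}}^*\setminus\{0\}}|u(w)|/\sqrt{q(u,u)}$ and $H:=\{h\in W:\|h\|_H<\infty\}$; $H$ is a dense complex subspace of $W$, and $\|\cdot\|_H$ comes from a unique complex inner product $\langle\cdot,\cdot\rangle_H$ making $H$ a separable complex Hilbert space continuously embedded in $W$. $\mathfrak{g}_{CM}=H\times\mathbf{C}$ is the Lie algebra with bracket $[(A,a),(B,b)]=(0,\omega(A,B))$ and inner product $\langle(A,a),(B,b)\rangle_{\mathfrak{g}_{CM}}=\langle A,B\rangle_H+\langle a,b\rangle_{\mathbf{C}}$.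 $\mathbf{T}=\bigoplus_{n\ge0}\mathfrak{g}_{CM}^{\otimes n}$ is the algebraic tensor algebra, $\mathbf{T}'$ its algebraic dual, $J$ the two-sided ideal of $\mathbf{T}$ generated by $\{h\otimes k-k\otimes h-[h,k]:h,k\in\mathfrak{g}_{CM}\}$, and $J^0=\{\alpha\in\mathbf{T}':\alpha(J)=0\}$. For $\alpha\in\mathbf{T}'$, $\alpha_n:=\alpha|_{\mathfrak{g}_{CM}^{\otimes n}}$ and $\|\alpha_n\|_n^2:=\sum_{h_1,\dots,h_n\in\Gamma}|\langle\alpha,h_1\otimes\dots\otimes h_n\rangle|^2$ (possibly $\infty$) with $\Gamma$ any orthonormal basis of $\mathfrak{g}_{CM}$. $\|\alpha\|^2_{J_T^0(\mathfrak{g}_{CM})}:=\sum_{n\ge0}\frac{T^n}{n!}\|\alpha_n\|_n^2$ and $J_T^0(\mathfrak{g}_{CM}):=\{\alpha\in J^0:\|\alpha\|_{J_T^0(\mathfrak{g}_{CM})}<\infty\}$, a Hilbert space. *)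

theory Defs
  imports
    "HOL-Probability.Probability"
    "HOL-Algebra.QuotRing"
    "HOL-Library.Poly_Mapping"
begin

subsection \<open>Complex vector spaces\<close>

class complex_vector = real_vector +
  fixes scaleC :: "complex \<Rightarrow> 'a \<Rightarrow> 'a"  (infixr \<open>*\<^sub>C\<close> 75)
  assumes scaleC_add_right: "c *\<^sub>C (x + y) = c *\<^sub>C x + c *\<^sub>C y"
    and scaleC_add_left: "(c + d) *\<^sub>C x = c *\<^sub>C x + d *\<^sub>C x"
    and scaleC_scaleC: "c *\<^sub>C d *\<^sub>C x = (c * d) *\<^sub>C x"
    and scaleC_of_real: "complex_of_real r *\<^sub>C x = r *\<^sub>R x"

class complex_normed_vector = complex_vector + real_normed_vector +
  assumes norm_scaleC: "norm (c *\<^sub>C x) = cmod c * norm x"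

class complex_banach = complex_normed_vector + banach

text \<open>Complex inner products are linear in the first and conjugate linear in the second argument.\<close>

class complex_inner = complex_normed_vector +
  fixes cinner :: "'a \<Rightarrow> 'a \<Rightarrow> complex"
  assumes cinner_commute: "cinner x y = cnj (cinner y x)"
    and cinner_add_left: "cinner (x + y) z = cinner x z + cinner y z"
    and cinner_scaleC_left: "cinner (c *\<^sub>C x) y = c * cinner x y"
    and cinner_self: "cinner x x = complex_of_real ((norm x)\<^sup>2)"

lemma vector_space_scaleC: "vector_space (scaleC :: complex \<Rightarrow> 'a \<Rightarrow> 'a::complex_vector)"
proof
  show "1 *\<^sub>C x = x" for x :: 'a
    using scaleC_of_real[of 1 x] by simp
qed (simp_all add: scaleC_add_right scaleC_add_left scaleC_scaleC)

abbreviation cspan :: "'a::complex_vector set \<Rightarrow> 'a set" where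
  "cspan \<equiv> module.span scaleC"

instantiation prod :: (complex_vector, complex_vector) complex_vector
begin

definition scaleC_prod_def: "c *\<^sub>C x = (c *\<^sub>C fst x, c *\<^sub>C snd x)"

instance
  by standard
    (simp_all add: scaleC_prod_def prod_eq_iff scaleC_add_right scaleC_add_left
      scaleC_scaleC scaleC_of_real)

end

subsection \<open>Complex abstract Wiener spaces\<close>

text \<open>The real dual of \<open>W\<close> is the type \<open>'w \<Rightarrow>\<^sub>L real\<close> of bounded real linear functionals.
  The form \<open>q\<close> is determined by \<open>\<mu>\<close>.\<close>

locale complex_abstract_wiener_space = prob_space \<mu>
  for \<mu> :: "'w::{complex_banach, second_countable_topology} measure" +
  fixes q :: "('w \<Rightarrow>\<^sub>L real) \<Rightarrow> ('w \<Rightarrow>\<^sub>L real) \<Rightarrow> real"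
  assumes sets_eq_borel: "sets \<mu> = sets borel"
    and q_bilinear: "bilinear q"
    and q_sym: "q u v = q v u"
    and q_pos: "u \<noteq> 0 \<Longrightarrow> 0 < q u u"
    and characteristic_function:
      "(\<integral>w. exp (\<i> * complex_of_real (blinfun_apply u w)) \<partial>\<mu>) = exp (- complex_of_real (q u u) / 2)"
    and invariant_under_i: "distr \<mu> \<mu> (\<lambda>w. \<i> *\<^sub>C w) = \<mu>"

definition cm_norm :: "(('w::complex_banach \<Rightarrow>\<^sub>L real) \<Rightarrow> ('w \<Rightarrow>\<^sub>L real) \<Rightarrow> real) \<Rightarrow> 'w \<Rightarrow> ennreal" where
  "cm_norm q w = (SUP u\<in>UNIV - {0}. ennreal (\<bar>blinfun_apply u w\<bar> / sqrt (q u u)))"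

definition cm_space :: "(('w::complex_banach \<Rightarrow>\<^sub>L real) \<Rightarrow> ('w \<Rightarrow>\<^sub>L real) \<Rightarrow> real) \<Rightarrow> 'w set" where
  "cm_space q = {h. cm_norm q h < \<infinity>}"

text \<open>The unique complex inner product on \<open>cm_space q\<close> inducing \<open>cm_norm q\<close>, recovered from
  the norm by polarization; only meaningful for arguments in \<open>cm_space q\<close>.\<close>

definition cm_inner ::
    "(('w::complex_banach \<Rightarrow>\<^sub>L real) \<Rightarrow> ('w \<Rightarrow>\<^sub>L real) \<Rightarrow> real) \<Rightarrow> 'w \<Rightarrow> 'w \<Rightarrow> complex" where
  "cm_inner q h k =
    (let N = (\<lambda>x. complex_of_real ((enn2real (cm_norm q x))\<^sup>2))
     in (N (h + k) - N (h - k) + \<i> * N (h + \<i> *\<^sub>C k) - \<i> * N (h - \<i> *\<^sub>C k)) / 4)"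

subsection \<open>The Cameron--Martin Lie algebra\<close>

definition continuous_skew_form :: "('w::complex_normed_vector \<Rightarrow> 'w \<Rightarrow> 'c::complex_normed_vector) \<Rightarrow> bool" where
  "continuous_skew_form \<omega> \<longleftrightarrow>
     bounded_bilinear \<omega> \<and>
     (\<forall>c x y. \<omega> (c *\<^sub>C x) y = c *\<^sub>C \<omega> x y \<and> \<omega> x (c *\<^sub>C y) = c *\<^sub>C \<omega> x y) \<and>
     (\<forall>x y. \<omega> x y = - \<omega> y x)"

text \<open>The norm and topology that the type \<open>'w \<times> 'c\<close> carries are not those of \<open>\<gg>\<^sub>C\<^sub>M\<close> and are not used.\<close>

definition g_CM :: "(('w::complex_banach \<Rightarrow>\<^sub>L real) \<Rightarrow> ('w \<Rightarrow>\<^sub>L real) \<Rightarrow> real) \<Rightarrow> ('w \<times> 'c::complex_inner) set" where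
  "g_CM q = cm_space q \<times> UNIV"

definition g_inner ::
    "(('w::complex_banach \<Rightarrow>\<^sub>L real) \<Rightarrow> ('w \<Rightarrow>\<^sub>L real) \<Rightarrow> real) \<Rightarrow> 'w \<times> 'c::complex_inner \<Rightarrow> 'w \<times> 'c \<Rightarrow> complex" where
  "g_inner q x y = cm_inner q (fst x) (fst y) + cinner (snd x) (snd y)"

definition g_norm ::
    "(('w::complex_banach \<Rightarrow>\<^sub>L real) \<Rightarrow> ('w \<Rightarrow>\<^sub>L real) \<Rightarrow> real) \<Rightarrow> 'w \<times> 'c::complex_inner \<Rightarrow> real" where
  "g_norm q x = sqrt (Re (g_inner q x x))"

definition g_bracket :: "('w \<Rightarrow> 'w \<Rightarrow> 'c::complex_inner) \<Rightarrow> 'w::complex_banach \<times> 'c \<Rightarrow> 'w \<times> 'c \<Rightarrow> 'w \<times> 'c" where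
  "g_bracket \<omega> x y = (0, \<omega> (fst x) (fst y))"

definition orthonormal_bases ::
    "(('w::complex_banach \<Rightarrow>\<^sub>L real) \<Rightarrow> ('w \<Rightarrow>\<^sub>L real) \<Rightarrow> real) \<Rightarrow> ('w \<times> 'c::complex_inner) set set" where
  "orthonormal_bases q =
     {\<Gamma>. \<Gamma> \<subseteq> g_CM q \<and>
         (\<forall>x\<in>\<Gamma>. \<forall>y\<in>\<Gamma>. g_inner q x y = (if x = y then 1 else 0)) \<and>
         (\<forall>x\<in>g_CM q. \<forall>\<epsilon>>0. \<exists>y\<in>cspan \<Gamma>. g_norm q (x - y) < \<epsilon>)}"

subsection \<open>The algebraic tensor algebra\<close>

text \<open>With concatenation as monoid operation on words, the convolution product of
  \<open>HOL-Library.Poly_Mapping\<close> makes \<open>'v list \<Rightarrow>\<^sub>0 complex\<close> the free unital associative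
  \<open>\<complex>\<close>-algebra on the set of letters \<open>'v\<close>.\<close>

instantiation list :: (type) monoid_add
begin

definition zero_list_def: "0 = []"
definition plus_list_def: "xs + ys = xs @ ys"

instance
  by standard (simp_all add: zero_list_def plus_list_def)

end

abbreviation word :: "complex \<Rightarrow> 'v list \<Rightarrow> ('v list \<Rightarrow>\<^sub>0 complex)" where
  "word c hs \<equiv> Poly_Mapping.single hs c"

definition free_algebra :: "'v set \<Rightarrow> ('v list \<Rightarrow>\<^sub>0 complex) ring" where
  "free_algebra V =
     \<lparr>carrier = {p. Poly_Mapping.keys p \<subseteq> lists V}, mult = (*), one = 1, zero = 0, add = (+)\<rparr>"

lemma keys_mult_subset_lists:
  assumes "Poly_Mapping.keys p \<subseteq> lists V" "Poly_Mapping.keys r \<subseteq> lists V"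
  shows "Poly_Mapping.keys (p * r :: 'v list \<Rightarrow>\<^sub>0 complex) \<subseteq> lists V"
  using Poly_Mapping.keys_mult[of p r] assms by (fastforce simp: plus_list_def)

lemma ring_free_algebra: "ring (free_algebra V)"
proof (rule ringI)
  show "abelian_group (free_algebra V)"
  proof (rule abelian_groupI)
    fix x assume "x \<in> carrier (free_algebra V)"
    then show "\<exists>y\<in>carrier (free_algebra V). y \<oplus>\<^bsub>free_algebra V\<^esub> x = \<zero>\<^bsub>free_algebra V\<^esub>"
      by (intro bexI[of _ "- x"]) (auto simp: free_algebra_def)
  qed (use Poly_Mapping.keys_add in \<open>fastforce simp: free_algebra_def algebra_simps\<close>)+
  show "Group.monoid (free_algebra V)"
    by (rule monoidI)
      (auto simp: free_algebra_def zero_list_def mult.assoc dest: keys_mult_subset_lists[THEN subsetD, rotated 2])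
qed (auto simp: free_algebra_def algebra_simps)

text \<open>The tensor algebra of the complex vector space \<open>V\<close> is the free algebra on the letters \<open>V\<close>
  modulo the ideal that makes \<open>h \<mapsto> word 1 [h]\<close> complex linear.  This ideal is the linear span
  of the multilinearity relations between words of equal length, so the quotient is the direct sum
  over \<open>n\<close> of the tensor powers \<open>tensor_power V n\<close>, each of which is the free vector space on
  \<open>V\<^sup>n\<close> modulo multilinearity.\<close>

definition linearity_ideal :: "'v::complex_vector set \<Rightarrow> ('v list \<Rightarrow>\<^sub>0 complex) set" where
  "linearity_ideal V = genideal (free_algebra V)
     {word 1 [c *\<^sub>C h + k] - word c [h] - word 1 [k] | c h k. h \<in> V \<and> k \<in> V \<and> c *\<^sub>C h + k \<in> V}"

definition tensor_algebra :: "'v::complex_vector set \<Rightarrow> (('v list \<Rightarrow>\<^sub>0 complex) set) ring" where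
  "tensor_algebra V = free_algebra V Quot linearity_ideal V"

definition tensor_class :: "'v::complex_vector set \<Rightarrow> ('v list \<Rightarrow>\<^sub>0 complex) \<Rightarrow> ('v list \<Rightarrow>\<^sub>0 complex) set" where
  "tensor_class V p = linearity_ideal V +>\<^bsub>free_algebra V\<^esub> p"

text \<open>\<open>tensor V [h\<^sub>1, \<dots>, h\<^sub>n]\<close> is \<open>h\<^sub>1 \<otimes> \<dots> \<otimes> h\<^sub>n\<close>.\<close>

definition tensor :: "'v::complex_vector set \<Rightarrow> 'v list \<Rightarrow> ('v list \<Rightarrow>\<^sub>0 complex) set" where
  "tensor V hs = tensor_class V (word 1 hs)"

definition tensor_scale ::
    "'v::complex_vector set \<Rightarrow> complex \<Rightarrow> ('v list \<Rightarrow>\<^sub>0 complex) set \<Rightarrow> ('v list \<Rightarrow>\<^sub>0 complex) set" where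
  "tensor_scale V c x = tensor_class V (word c []) \<otimes>\<^bsub>tensor_algebra V\<^esub> x"

definition tensor_power :: "'v::complex_vector set \<Rightarrow> nat \<Rightarrow> ('v list \<Rightarrow>\<^sub>0 complex) set set" where
  "tensor_power V n =
     {tensor_class V p | p. Poly_Mapping.keys p \<subseteq> {hs \<in> lists V. length hs = n}}"

lemma ring_tensor_algebra: "ring (tensor_algebra V)"
proof -
  interpret ring "free_algebra V" by (rule ring_free_algebra)
  have "word 1 [c *\<^sub>C h + k] - word c [h] - word 1 [k] \<in> carrier (free_algebra V)"
    if "h \<in> V" "k \<in> V" "c *\<^sub>C h + k \<in> V" for c h k
    using that Poly_Mapping.keys_diff[of "word 1 [c *\<^sub>C h + k] - word c [h]" "word 1 [k]"]
      Poly_Mapping.keys_diff[of "word 1 [c *\<^sub>C h + k]" "word c [h]"]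
    by (fastforce simp: free_algebra_def split: if_splits)
  then have "ideal (linearity_ideal V) (free_algebra V)"
    unfolding linearity_ideal_def by (intro genideal_ideal) auto
  then show ?thesis
    unfolding tensor_algebra_def by (rule ideal.quotient_is_ring)
qed

text \<open>Functionals are set to \<open>0\<close> off the carrier, so that they form a vector space under pointwise
  operations and are equal iff they agree on the tensor algebra.\<close>

definition tensor_dual :: "'v::complex_vector set \<Rightarrow> (('v list \<Rightarrow>\<^sub>0 complex) set \<Rightarrow> complex) set" where
  "tensor_dual V =
     {\<alpha>. (\<forall>x\<in>carrier (tensor_algebra V). \<forall>y\<in>carrier (tensor_algebra V).
            \<alpha> (x \<oplus>\<^bsub>tensor_algebra V\<^esub> y) = \<alpha> x + \<alpha> y) \<and>
         (\<forall>c. \<forall>x\<in>carrier (tensor_algebra V). \<alpha> (tensor_scale V c x) = c * \<alpha> x) \<and>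
         (\<forall>x. x \<notin> carrier (tensor_algebra V) \<longrightarrow> \<alpha> x = 0)}"

subsection \<open>The space \<open>J\<^sup>0\<^sub>T(\<gg>\<^sub>C\<^sub>M)\<close>\<close>

definition J_ideal :: "'v::complex_vector set \<Rightarrow> ('v \<Rightarrow> 'v \<Rightarrow> 'v) \<Rightarrow> ('v list \<Rightarrow>\<^sub>0 complex) set set" where
  "J_ideal V br = genideal (tensor_algebra V)
     {tensor V [h, k] \<ominus>\<^bsub>tensor_algebra V\<^esub> tensor V [k, h] \<ominus>\<^bsub>tensor_algebra V\<^esub> tensor V [br h k]
       | h k. h \<in> V \<and> k \<in> V}"

definition J_annihilator ::
    "'v::complex_vector set \<Rightarrow> ('v \<Rightarrow> 'v \<Rightarrow> 'v) \<Rightarrow> (('v list \<Rightarrow>\<^sub>0 complex) set \<Rightarrow> complex) set" where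
  "J_annihilator V br = {\<alpha> \<in> tensor_dual V. \<forall>x\<in>J_ideal V br. \<alpha> x = 0}"

definition basis_sqnorm ::
    "'v::complex_vector set \<Rightarrow> 'v set \<Rightarrow> nat \<Rightarrow> (('v list \<Rightarrow>\<^sub>0 complex) set \<Rightarrow> complex) \<Rightarrow> ennreal" where
  "basis_sqnorm V \<Gamma> n \<alpha> =
     (\<Sum>\<^sub>\<infinity>hs\<in>{hs \<in> lists \<Gamma>. length hs = n}. ennreal ((cmod (\<alpha> (tensor V hs)))\<^sup>2))"

text \<open>The sum in \<open>basis_sqnorm\<close> does not depend on the orthonormal basis \<open>\<Gamma>\<close> as long as
  \<open>\<alpha>\<^sub>n\<close> is continuous; then the supremum is the common value.  For an algebraic functional with
  discontinuous \<open>\<alpha>\<^sub>n\<close> the sum may depend on \<open>\<Gamma>\<close> (and may even vanish for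
  \<open>\<alpha>\<^sub>n \<noteq> 0\<close>); then the supremum is \<open>\<infinity>\<close>.  This is what makes \<open>J0_T\<close> below a Hilbert space
  rather than a basis-dependent seminormed space.\<close>

definition degree_sqnorm ::
    "(('w::complex_banach \<Rightarrow>\<^sub>L real) \<Rightarrow> ('w \<Rightarrow>\<^sub>L real) \<Rightarrow> real) \<Rightarrow> nat \<Rightarrow>
      ((('w \<times> 'c::complex_inner) list \<Rightarrow>\<^sub>0 complex) set \<Rightarrow> complex) \<Rightarrow> ennreal" where
  "degree_sqnorm q n \<alpha> = (SUP \<Gamma>\<in>orthonormal_bases q. basis_sqnorm (g_CM q) \<Gamma> n \<alpha>)"

definition J0_sqnorm ::
    "(('w::complex_banach \<Rightarrow>\<^sub>L real) \<Rightarrow> ('w \<Rightarrow>\<^sub>L real) \<Rightarrow> real) \<Rightarrow> real \<Rightarrow>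
      ((('w \<times> 'c::complex_inner) list \<Rightarrow>\<^sub>0 complex) set \<Rightarrow> complex) \<Rightarrow> ennreal" where
  "J0_sqnorm q T \<alpha> = suminf (\<lambda>n. ennreal (T ^ n / fact n) * degree_sqnorm q n \<alpha>)"

definition J0_T ::
    "(('w::complex_banach \<Rightarrow>\<^sub>L real) \<Rightarrow> ('w \<Rightarrow>\<^sub>L real) \<Rightarrow> real) \<Rightarrow> ('w \<Rightarrow> 'w \<Rightarrow> 'c::complex_inner) \<Rightarrow> real \<Rightarrow>
      ((('w \<times> 'c) list \<Rightarrow>\<^sub>0 complex) set \<Rightarrow> complex) set" where
  "J0_T q \<omega> T = {\<alpha> \<in> J_annihilator (g_CM q) (g_bracket \<omega>). J0_sqnorm q T \<alpha> < \<infinity>}"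

definition finite_rank :: "'v::complex_vector set \<Rightarrow> (('v list \<Rightarrow>\<^sub>0 complex) set \<Rightarrow> complex) \<Rightarrow> bool" where
  "finite_rank V \<alpha> \<longleftrightarrow> finite {n. \<exists>x\<in>tensor_power V n. \<alpha> x \<noteq> 0}"

end

theory Submission
  imports Defs
begin

text \<open>
  The reason for the density is that \<open>\<gg>\<^sub>C\<^sub>M\<close> is graded. Give \<open>(A, 0)\<close> weight \<open>1\<close> and \<open>(0, a)\<close> weight
  \<open>2\<close>. The dilation \<open>\<delta>\<^sub>z (A, a) = (z A, z\<^sup>2 a)\<close> respects the bracket, because \<open>\<omega>\<close> is bilinear and takes
  its values in the summand of weight \<open>2\<close>. For \<open>\<bar>z\<bar> = 1\<close> it is also unitary: since \<open>\<mu>\<close> is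
  invariant under multiplication by \<open>\<i>\<close>, its covariance \<open>q\<close>, and with it the Cameron--Martin norm, is
  invariant under the whole circle. So \<open>\<delta>\<^sub>z\<close> permutes the orthonormal bases
  (\<open>orthonormal_bases_dilation\<close>), and \<open>\<alpha> \<mapsto> \<alpha> \<circ> \<delta>\<^sub>z\<close> preserves every degree norm.

  Multilinearity makes \<open>z \<mapsto> \<alpha> (\<delta>\<^sub>z h\<^sub>1 \<otimes> \<dots> \<otimes> \<delta>\<^sub>z h\<^sub>n)\<close> a polynomial on the unit circle all of whose
  exponents lie between \<open>n\<close> and \<open>2 n\<close> (\<open>weight_expansion\<close>). Its \<open>m\<close>-th coefficient is the component of \<open>\<alpha>\<close> of
  weight \<open>m\<close>. Multiplying these components by scalars \<open>c\<^sub>m\<close> and adding them up again gives a functional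
  \<open>\<beta>\<close>, here called \<open>reweight c\<close>. It annihilates \<open>J\<close> whenever \<open>\<alpha>\<close> does, since the polynomial depends
  linearly on the tensor and satisfies the Lie relations for each \<open>z\<close> (\<open>lie_compatible_reweight\<close>).
  If \<open>c\<close> has finite support, then \<open>\<beta>\<close> has finite rank: a tensor of degree \<open>n\<close> only has components
  of weight at least \<open>n\<close>.

  It remains to choose \<open>c\<close> so that \<open>\<beta>\<close> is close to \<open>\<alpha>\<close>. The de la Vallee-Poussin multiplier is
  \<open>1\<close> for \<open>m \<le> K\<close> and \<open>0\<close> for \<open>m \<ge> 2 K\<close>. Being a combination of two Fejer kernels, it writes \<open>\<beta>\<close> in each
  degree as an average of the functionals \<open>\<alpha> \<circ> \<delta>\<^sub>z\<close> over roots of unity \<open>z\<close> whose coefficients have total mass at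
  most \<open>3\<close>, whatever the degree and \<open>K\<close> (\<open>bounded_multiplier_vallee_poussin\<close>). Hence
  \<open>\<parallel>\<beta>\<^sub>n\<parallel> \<le> 3 \<parallel>\<alpha>\<^sub>n\<parallel>\<close> and \<open>\<parallel>\<alpha>\<^sub>n - \<beta>\<^sub>n\<parallel> \<le> 4 \<parallel>\<alpha>\<^sub>n\<parallel>\<close> (\<open>degree_sqnorm_reweight_le\<close>), while \<open>\<alpha>\<^sub>n = \<beta>\<^sub>n\<close> for
  \<open>2 n \<le> K\<close>. So \<open>\<parallel>\<alpha> - \<beta>\<parallel>\<^sup>2\<close> is at most \<open>16\<close> times a tail of the convergent series \<open>\<parallel>\<alpha>\<parallel>\<^sup>2\<close>.
  A uniform bound of this kind is the reason for not simply cutting off at weight \<open>K\<close>: the mass of the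
  Dirichlet kernel is not bounded in \<open>K\<close>.
\<close>

section \<open>Functionals on the tensor algebra as multilinear functions on words\<close>

text \<open>The linear extension of a function on words to the free algebra.\<close>
definition word_eval :: "('v list \<Rightarrow> complex) \<Rightarrow> ('v list \<Rightarrow>\<^sub>0 complex) \<Rightarrow> complex" where
  "word_eval f p = (\<Sum>hs\<in>Poly_Mapping.keys p. Poly_Mapping.lookup p hs * f hs)"

lemma word_eval_superset:
  assumes "finite A" "Poly_Mapping.keys p \<subseteq> A"
  shows "word_eval f p = (\<Sum>hs\<in>A. Poly_Mapping.lookup p hs * f hs)"
  unfolding word_eval_def using assms
  by (intro sum.mono_neutral_left) (auto simp: in_keys_iff)

lemma word_eval_single [simp]: "word_eval f (word c hs) = c * f hs"
  using word_eval_superset[of "{hs}" "word c hs" f] by (simp add: lookup_single)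

lemma word_eval_zero [simp]: "word_eval f 0 = 0"
  by (simp add: word_eval_def)

lemma word_eval_add: "word_eval f (p + r) = word_eval f p + word_eval f r"
proof -
  let ?A = "Poly_Mapping.keys p \<union> Poly_Mapping.keys r"
  have "finite ?A" by simp
  moreover have "Poly_Mapping.keys (p + r) \<subseteq> ?A" by (rule Poly_Mapping.keys_add)
  ultimately show ?thesis
    by (simp add: word_eval_superset[of ?A] lookup_add distrib_right sum.distrib)
qed

lemma word_eval_diff: "word_eval f (p - r) = word_eval f p - word_eval f r"
  using word_eval_add[of f "p - r" r] by simp

lemma word_eval_sum: "word_eval f (\<Sum>i\<in>I. g i) = (\<Sum>i\<in>I. word_eval f (g i))"
  by (induction I rule: infinite_finite_induct) (simp_all add: word_eval_add)

lemma sum_of_words: "p = (\<Sum>hs\<in>Poly_Mapping.keys p. word (Poly_Mapping.lookup p hs) hs)"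
proof (rule poly_mapping_eqI)
  fix k
  show "Poly_Mapping.lookup p k =
    Poly_Mapping.lookup (\<Sum>hs\<in>Poly_Mapping.keys p. word (Poly_Mapping.lookup p hs) hs) k"
    by (cases "k \<in> Poly_Mapping.keys p")
      (simp_all add: lookup_sum lookup_single when_def in_keys_iff)
qed

lemma word_eval_mult: "word_eval f (p * r) = word_eval (\<lambda>us. word_eval (\<lambda>vs. f (us @ vs)) r) p"
proof -
  have "p * r = (\<Sum>us\<in>Poly_Mapping.keys p. \<Sum>vs\<in>Poly_Mapping.keys r.
      word (Poly_Mapping.lookup p us * Poly_Mapping.lookup r vs) (us @ vs))"
    by (subst sum_of_words[of p], subst sum_of_words[of r])
      (simp add: sum_product mult_single plus_list_def)
  then show ?thesis
    by (simp add: word_eval_sum word_eval_def[of _ p] word_eval_def[of _ r] sum_distrib_left mult.assoc)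
qed

lemma word_eval_swap:
  "word_eval (\<lambda>us. word_eval (\<lambda>vs. f us vs) r) p = word_eval (\<lambda>vs. word_eval (\<lambda>us. f us vs) p) r"
  unfolding word_eval_def sum_distrib_left by (subst sum.swap) (simp add: mult.left_commute)

lemma word_eval_eq_0: "(\<And>hs. hs \<in> Poly_Mapping.keys p \<Longrightarrow> f hs = 0) \<Longrightarrow> word_eval f p = 0"
  by (simp add: word_eval_def)

lemma word_carrier [simp]: "word c hs \<in> carrier (free_algebra V) \<longleftrightarrow> c = 0 \<or> hs \<in> lists V"
  by (auto simp: free_algebra_def)

lemma free_algebra_simps:
  "x \<oplus>\<^bsub>free_algebra V\<^esub> y = x + y" "x \<otimes>\<^bsub>free_algebra V\<^esub> y = x * y" "\<zero>\<^bsub>free_algebra V\<^esub> = 0"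
  by (simp_all add: free_algebra_def)

lemma carrier_add: "p \<in> carrier (free_algebra V) \<Longrightarrow> r \<in> carrier (free_algebra V)
    \<Longrightarrow> p + r \<in> carrier (free_algebra V)"
  using ring.ring_simprules(1)[OF ring_free_algebra, of p V r] by (simp add: free_algebra_simps)

lemma carrier_mult: "p \<in> carrier (free_algebra V) \<Longrightarrow> r \<in> carrier (free_algebra V)
    \<Longrightarrow> p * r \<in> carrier (free_algebra V)"
  using ring.ring_simprules(5)[OF ring_free_algebra, of p V r] by (simp add: free_algebra_simps)

lemma carrier_diff: "p \<in> carrier (free_algebra V) \<Longrightarrow> r \<in> carrier (free_algebra V)
    \<Longrightarrow> p - r \<in> carrier (free_algebra V)"
  using Poly_Mapping.keys_diff[of p r] by (auto simp: free_algebra_def)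

text \<open>The largest ideal of the free algebra on which \<open>f\<close> vanishes. A functional kills the ideal generated
  by some relations as soon as these relations lie in here, which reduces statements about
  generated ideals to their generators.\<close>
definition kernel_ideal :: "'v set \<Rightarrow> ('v list \<Rightarrow> complex) \<Rightarrow> ('v list \<Rightarrow>\<^sub>0 complex) set" where
  "kernel_ideal V f = {p \<in> carrier (free_algebra V).
     \<forall>us\<in>lists V. \<forall>vs\<in>lists V. word_eval (\<lambda>hs. f (us @ hs @ vs)) p = 0}"

lemma kernel_idealD:
  "p \<in> kernel_ideal V f \<Longrightarrow> us \<in> lists V \<Longrightarrow> vs \<in> lists V \<Longrightarrow> word_eval (\<lambda>hs. f (us @ hs @ vs)) p = 0"
  by (simp add: kernel_ideal_def)

lemma kernel_ideal_eval: "p \<in> kernel_ideal V f \<Longrightarrow> word_eval f p = 0"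
  by (force simp: kernel_ideal_def dest: bspec[where x = "[]"])

lemma ideal_kernel_ideal: "ideal (kernel_ideal V f) (free_algebra V)"
proof (rule idealI)
  interpret ring "free_algebra V" by (rule ring_free_algebra)
  show "ring (free_algebra V)" by (rule ring_free_algebra)
  show "subgroup (kernel_ideal V f) (add_monoid (free_algebra V))"
  proof (rule add.subgroupI)
    fix p assume p: "p \<in> kernel_ideal V f"
    then have "\<ominus>\<^bsub>free_algebra V\<^esub> p = - p"
      by (intro minus_equality) (auto simp: free_algebra_def kernel_ideal_def)
    with p show "\<ominus>\<^bsub>free_algebra V\<^esub> p \<in> kernel_ideal V f"
      using word_eval_diff[of _ 0 p] by (auto simp: kernel_ideal_def free_algebra_def)
  next
    have "0 \<in> kernel_ideal V f" by (simp add: kernel_ideal_def free_algebra_def)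
    then show "kernel_ideal V f \<noteq> {}" by blast
  next
    fix p r assume "p \<in> kernel_ideal V f" "r \<in> kernel_ideal V f"
    then show "p \<oplus>\<^bsub>free_algebra V\<^esub> r \<in> kernel_ideal V f"
      by (auto simp: kernel_ideal_def free_algebra_simps word_eval_add intro: carrier_add)
  qed (auto simp: kernel_ideal_def)
next
  fix p r assume p: "p \<in> kernel_ideal V f" and r: "r \<in> carrier (free_algebra V)"
  have rkeys: "hs \<in> lists V" if "hs \<in> Poly_Mapping.keys r" for hs
    using r that by (auto simp: free_algebra_def)
  have carr: "r * p \<in> carrier (free_algebra V)" "p * r \<in> carrier (free_algebra V)"
    using p r ring.ring_simprules(5)[OF ring_free_algebra, of r V p]
      ring.ring_simprules(5)[OF ring_free_algebra, of p V r]
    by (auto simp: kernel_ideal_def free_algebra_def)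
  have "word_eval (\<lambda>hs. f (us @ hs @ vs)) (r * p) = 0"
    if "us \<in> lists V" "vs \<in> lists V" for us vs
    unfolding word_eval_mult
  proof (rule word_eval_eq_0)
    fix ks assume "ks \<in> Poly_Mapping.keys r"
    with that rkeys have "us @ ks \<in> lists V" by auto
    then have "word_eval (\<lambda>hs. f ((us @ ks) @ hs @ vs)) p = 0"
      by (rule kernel_idealD[OF p _ that(2)])
    then show "word_eval (\<lambda>hs. f (us @ (ks @ hs) @ vs)) p = 0" by simp
  qed
  with carr show "r \<otimes>\<^bsub>free_algebra V\<^esub> p \<in> kernel_ideal V f"
    by (simp add: kernel_ideal_def) (simp add: free_algebra_def)
  have "word_eval (\<lambda>hs. f (us @ hs @ vs)) (p * r) = 0"
    if "us \<in> lists V" "vs \<in> lists V" for us vs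
    unfolding word_eval_mult word_eval_swap[of _ r p]
  proof (rule word_eval_eq_0)
    fix ks assume "ks \<in> Poly_Mapping.keys r"
    with that rkeys have "ks @ vs \<in> lists V" by auto
    then have "word_eval (\<lambda>hs. f (us @ hs @ (ks @ vs))) p = 0"
      by (rule kernel_idealD[OF p that(1)])
    then show "word_eval (\<lambda>hs. f (us @ (hs @ ks) @ vs)) p = 0" by simp
  qed
  with carr show "p \<otimes>\<^bsub>free_algebra V\<^esub> r \<in> kernel_ideal V f"
    by (simp add: kernel_ideal_def) (simp add: free_algebra_def)
qed

lemma free_algebra_minus:
  assumes "p \<in> carrier (free_algebra V)" "r \<in> carrier (free_algebra V)"
  shows "p \<ominus>\<^bsub>free_algebra V\<^esub> r = p - r"
proof -
  interpret ring "free_algebra V" by (rule ring_free_algebra)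
  have "\<ominus>\<^bsub>free_algebra V\<^esub> r = - r"
    using assms by (intro minus_equality) (auto simp: free_algebra_def)
  then show ?thesis by (simp add: a_minus_def free_algebra_simps)
qed

lemma ideal_linearity_ideal: "ideal (linearity_ideal V) (free_algebra V)"
  unfolding linearity_ideal_def
  by (intro ring.genideal_ideal ring_free_algebra subsetI)
    (auto intro!: carrier_diff)

lemma tensor_class_hom: "tensor_class V \<in> ring_hom (free_algebra V) (tensor_algebra V)"
  using ideal.rcos_ring_hom[OF ideal_linearity_ideal[of V]]
  by (simp add: tensor_class_def[abs_def] tensor_algebra_def)

lemma carrier_tensor_algebra:
  "carrier (tensor_algebra V) = tensor_class V ` carrier (free_algebra V)"
  by (auto simp: tensor_algebra_def FactRing_def A_RCOSETS_def' tensor_class_def)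

lemma tensor_class_add:
  assumes "p \<in> carrier (free_algebra V)" "r \<in> carrier (free_algebra V)"
  shows "tensor_class V (p + r) = tensor_class V p \<oplus>\<^bsub>tensor_algebra V\<^esub> tensor_class V r"
  using ring_hom_add[OF tensor_class_hom assms] by (simp add: free_algebra_simps)

lemma tensor_class_mult:
  assumes "p \<in> carrier (free_algebra V)" "r \<in> carrier (free_algebra V)"
  shows "tensor_class V (p * r) = tensor_class V p \<otimes>\<^bsub>tensor_algebra V\<^esub> tensor_class V r"
  using ring_hom_mult[OF tensor_class_hom assms] by (simp add: free_algebra_simps)

lemma tensor_class_diff:
  assumes "p \<in> carrier (free_algebra V)" "r \<in> carrier (free_algebra V)"
  shows "tensor_class V (p - r) = tensor_class V p \<ominus>\<^bsub>tensor_algebra V\<^esub> tensor_class V r"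
proof -
  interpret T: ring "tensor_algebra V" by (rule ring_tensor_algebra)
  have "tensor_class V p = tensor_class V (p - r) \<oplus>\<^bsub>tensor_algebra V\<^esub> tensor_class V r"
    using tensor_class_add[OF carrier_diff[OF assms] assms(2)] by simp
  moreover have "tensor_class V s \<in> carrier (tensor_algebra V)" if "s \<in> carrier (free_algebra V)" for s
    using that by (simp add: carrier_tensor_algebra)
  ultimately show ?thesis using assms carrier_diff[OF assms]
    by (simp add: a_minus_def T.a_assoc T.r_neg)
qed

lemma tensor_class_eqD:
  assumes "p \<in> carrier (free_algebra V)" "r \<in> carrier (free_algebra V)"
    and "tensor_class V p = tensor_class V r"
  shows "p - r \<in> linearity_ideal V"
proof -
  interpret R: ring "free_algebra V" by (rule ring_free_algebra)
  interpret I: ideal "linearity_ideal V" "free_algebra V" by (rule ideal_linearity_ideal)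
  have "p \<in> linearity_ideal V +>\<^bsub>free_algebra V\<^esub> p"
    using I.a_rcos_self assms by simp
  then have "p \<in> linearity_ideal V +>\<^bsub>free_algebra V\<^esub> r"
    using assms(3) by (simp add: tensor_class_def)
  then have "p \<ominus>\<^bsub>free_algebra V\<^esub> r \<in> linearity_ideal V"
    using I.a_rcos_module_minus assms R.ring_axioms by blast
  then show ?thesis using free_algebra_minus assms by metis
qed

definition multilinear_on :: "'v::complex_vector set \<Rightarrow> ('v list \<Rightarrow> complex) \<Rightarrow> bool" where
  "multilinear_on V f \<longleftrightarrow> (\<forall>us\<in>lists V. \<forall>vs\<in>lists V. \<forall>c h k. h \<in> V \<longrightarrow> k \<in> V \<longrightarrow> c *\<^sub>C h + k \<in> V \<longrightarrow>
     f (us @ [c *\<^sub>C h + k] @ vs) = c * f (us @ [h] @ vs) + f (us @ [k] @ vs))"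

text \<open>This is what lets a multilinear function of words descend to the tensor algebra.\<close>
lemma linearity_ideal_subset_kernel:
  assumes "multilinear_on V f"
  shows "linearity_ideal V \<subseteq> kernel_ideal V f"
  unfolding linearity_ideal_def
proof (rule ring.genideal_minimal[OF ring_free_algebra ideal_kernel_ideal], safe)
  fix c h k assume *: "h \<in> V" "k \<in> V" "c *\<^sub>C h + k \<in> V"
  then show "word 1 [c *\<^sub>C h + k] - word c [h] - word 1 [k] \<in> kernel_ideal V f"
    using assms by (auto simp: kernel_ideal_def word_eval_diff multilinear_on_def intro!: carrier_diff)
qed

text \<open>The value on a class is read off from an arbitrary representative; by
  \<open>tensor_functional_class\<close> the choice does not matter for multilinear \<open>f\<close>.\<close>
definition tensor_functional ::
    "'v::complex_vector set \<Rightarrow> ('v list \<Rightarrow> complex) \<Rightarrow> ('v list \<Rightarrow>\<^sub>0 complex) set \<Rightarrow> complex" where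
  "tensor_functional V f x =
     (if x \<in> carrier (tensor_algebra V)
      then word_eval f (SOME p. p \<in> carrier (free_algebra V) \<and> x = tensor_class V p) else 0)"

lemma tensor_functional_class:
  assumes "multilinear_on V f" and p: "p \<in> carrier (free_algebra V)"
  shows "tensor_functional V f (tensor_class V p) = word_eval f p"
proof -
  define r where "r = (SOME r. r \<in> carrier (free_algebra V) \<and> tensor_class V p = tensor_class V r)"
  have r: "r \<in> carrier (free_algebra V)" "tensor_class V p = tensor_class V r"
    using someI[of "\<lambda>r. r \<in> carrier (free_algebra V) \<and> tensor_class V p = tensor_class V r" p] p
    unfolding r_def by auto
  have "p - r \<in> kernel_ideal V f"
    using tensor_class_eqD[OF p r] linearity_ideal_subset_kernel[OF assms(1)] by blast
  then have "word_eval f p = word_eval f r"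
    using kernel_ideal_eval[of "p - r" V f] by (simp add: word_eval_diff)
  then show ?thesis
    using p by (simp add: tensor_functional_def carrier_tensor_algebra r_def)
qed

lemma tensor_functional_tensor:
  assumes "multilinear_on V f" "hs \<in> lists V"
  shows "tensor_functional V f (tensor V hs) = f hs"
  using tensor_functional_class[OF assms(1), of "word 1 hs"] assms(2) by (simp add: tensor_def)

lemma tensor_scale_class:
  assumes "p \<in> carrier (free_algebra V)"
  shows "tensor_scale V c (tensor_class V p) = tensor_class V (word c [] * p)"
  using assms by (simp add: tensor_scale_def tensor_class_mult)

lemma tensor_functional_in_dual:
  assumes f: "multilinear_on V f"
  shows "tensor_functional V f \<in> tensor_dual V"
proof -
  have "tensor_functional V f (tensor_scale V c (tensor_class V p)) = c * tensor_functional V f (tensor_class V p)"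
    if "p \<in> carrier (free_algebra V)" for c p
    using that by (simp add: tensor_scale_class tensor_functional_class[OF f] carrier_mult word_eval_mult)
  moreover have "tensor_functional V f (tensor_class V p \<oplus>\<^bsub>tensor_algebra V\<^esub> tensor_class V r) =
      tensor_functional V f (tensor_class V p) + tensor_functional V f (tensor_class V r)"
    if "p \<in> carrier (free_algebra V)" "r \<in> carrier (free_algebra V)" for p r
    using that tensor_class_add[of p V r, symmetric]
    by (simp add: tensor_functional_class[OF f] carrier_add word_eval_add)
  ultimately show ?thesis
    unfolding tensor_dual_def by (auto simp: carrier_tensor_algebra tensor_functional_def)
qed

text \<open>A functional is determined by its values on pure tensors. Together with
  \<open>multilinear_on_tensor_dual\<close> and \<open>tensor_functional_in_dual\<close> this identifies the dual of the tensor algebra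
  with the multilinear functions of words.\<close>
lemma tensor_dual_class:
  assumes \<alpha>: "\<alpha> \<in> tensor_dual V" and p: "p \<in> carrier (free_algebra V)"
  shows "\<alpha> (tensor_class V p) = word_eval (\<lambda>hs. \<alpha> (tensor V hs)) p"
proof -
  have scale: "\<alpha> (tensor_class V (word c hs)) = c * \<alpha> (tensor V hs)" if "hs \<in> lists V" for c hs
  proof -
    have "tensor_class V (word c hs) = tensor_scale V c (tensor V hs)"
      using that by (simp add: tensor_def tensor_scale_class mult_single plus_list_def)
    with that \<alpha> show ?thesis
      by (auto simp: tensor_dual_def carrier_tensor_algebra tensor_def)
  qed
  have zero: "\<alpha> (tensor_class V 0) = 0" using scale[of "[]" 0] by simp
  have "\<alpha> (tensor_class V (\<Sum>hs\<in>A. word (g hs) hs)) = (\<Sum>hs\<in>A. g hs * \<alpha> (tensor V hs)) \<and>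
      (\<Sum>hs\<in>A. word (g hs) hs) \<in> carrier (free_algebra V)"
    if "finite A" "A \<subseteq> lists V" for A g
    using that
  proof (induction A rule: finite_induct)
    case empty
    then show ?case using zero by (simp add: free_algebra_def)
  next
    case (insert hs A)
    define s where "s = (\<Sum>hs\<in>A. word (g hs) hs)"
    have w: "word (g hs) hs \<in> carrier (free_algebra V)" and s: "s \<in> carrier (free_algebra V)"
      using insert by (auto simp: s_def)
    have "\<alpha> (tensor_class V (word (g hs) hs + s)) = \<alpha> (tensor_class V (word (g hs) hs)) + \<alpha> (tensor_class V s)"
      unfolding tensor_class_add[OF w s] using \<alpha> w s
      by (simp add: tensor_dual_def carrier_tensor_algebra)
    then show ?case
      using insert scale[of hs "g hs"] carrier_add[OF w s] by (simp add: s_def)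
  qed
  from this[of "Poly_Mapping.keys p" "Poly_Mapping.lookup p"] p show ?thesis
    using sum_of_words[of p] by (simp add: word_eval_def free_algebra_def)
qed

lemma multilinear_on_tensor_dual:
  assumes \<alpha>: "\<alpha> \<in> tensor_dual V"
  shows "multilinear_on V (\<lambda>hs. \<alpha> (tensor V hs))"
  unfolding multilinear_on_def
proof (intro ballI allI impI)
  fix us vs c h k
  assume *: "us \<in> lists V" "vs \<in> lists V" "h \<in> V" "k \<in> V" "c *\<^sub>C h + k \<in> V"
  define g where "g = word 1 [c *\<^sub>C h + k] - word c [h] - word 1 [k]"
  define p where "p = word 1 us * g * word 1 vs"
  interpret I: ideal "linearity_ideal V" "free_algebra V" by (rule ideal_linearity_ideal)
  have "g \<in> linearity_ideal V"
    unfolding linearity_ideal_def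
    by (rule set_mp[OF ring.genideal_self[OF ring_free_algebra]])
      (use * in \<open>auto simp: g_def intro!: carrier_diff\<close>)
  then have pI: "p \<in> linearity_ideal V"
    using I.I_l_closed[of g "word 1 us"] I.I_r_closed[of "word 1 us * g" "word 1 vs"] *
    by (simp add: p_def free_algebra_simps)
  then have pc: "p \<in> carrier (free_algebra V)" by (rule I.a_Hcarr)
  have zc: "(0::'a list \<Rightarrow>\<^sub>0 complex) \<in> carrier (free_algebra V)" by (simp add: free_algebra_def)
  have "tensor_class V p = linearity_ideal V"
    using pI I.a_rcos_const by (simp add: tensor_class_def)
  also have "\<dots> = tensor_class V 0"
    using I.a_rcos_const[OF additive_subgroup.zero_closed[OF I.additive_subgroup_axioms]] by (simp add: tensor_class_def free_algebra_simps)
  finally have "word_eval (\<lambda>hs. \<alpha> (tensor V hs)) p = 0"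
    using tensor_dual_class[OF \<alpha> pc] tensor_dual_class[OF \<alpha> zc] by simp
  then show "\<alpha> (tensor V (us @ [c *\<^sub>C h + k] @ vs)) =
      c * \<alpha> (tensor V (us @ [h] @ vs)) + \<alpha> (tensor V (us @ [k] @ vs))"
    by (simp add: p_def g_def word_eval_mult word_eval_diff diff_eq_eq add.commute)
qed

section \<open>The Lie relations\<close>

text \<open>For a multilinear function of words, this describes the annihilator of \<open>J\<close>: the two lemmas that close this section
  are the two directions.\<close>
definition lie_compatible :: "'v set \<Rightarrow> ('v \<Rightarrow> 'v \<Rightarrow> 'v) \<Rightarrow> ('v list \<Rightarrow> complex) \<Rightarrow> bool" where
  "lie_compatible V br f \<longleftrightarrow> (\<forall>us\<in>lists V. \<forall>vs\<in>lists V. \<forall>h\<in>V. \<forall>k\<in>V.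
     f (us @ [h, k] @ vs) - f (us @ [k, h] @ vs) = f (us @ [br h k] @ vs))"

definition lie_relator :: "('v \<Rightarrow> 'v \<Rightarrow> 'v) \<Rightarrow> 'v \<Rightarrow> 'v \<Rightarrow> ('v list \<Rightarrow>\<^sub>0 complex)" where
  "lie_relator br h k = word 1 [h, k] - word 1 [k, h] - word 1 [br h k]"

text \<open>Lifting the generators of \<open>J\<close> to the free algebra makes them accessible to \<open>word_eval\<close>.\<close>
lemma J_ideal_eq:
  assumes "\<And>h k. h \<in> V \<Longrightarrow> k \<in> V \<Longrightarrow> br h k \<in> V"
  shows "J_ideal V br = genideal (tensor_algebra V)
    {tensor_class V (lie_relator br h k) | h k. h \<in> V \<and> k \<in> V}"
proof -
  have "tensor_class V (lie_relator br h k) = tensor V [h, k] \<ominus>\<^bsub>tensor_algebra V\<^esub> tensor V [k, h]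
      \<ominus>\<^bsub>tensor_algebra V\<^esub> tensor V [br h k]" if "h \<in> V" "k \<in> V" for h k
    using that assms[OF that]
    by (simp add: lie_relator_def tensor_class_diff carrier_diff tensor_def)
  then have "{tensor V [h, k] \<ominus>\<^bsub>tensor_algebra V\<^esub> tensor V [k, h] \<ominus>\<^bsub>tensor_algebra V\<^esub> tensor V [br h k]
       | h k. h \<in> V \<and> k \<in> V} = {tensor_class V (lie_relator br h k) | h k. h \<in> V \<and> k \<in> V}"
    by (auto; metis)
  then show ?thesis unfolding J_ideal_def by simp
qed

lemma lie_relator_carrier:
  assumes "h \<in> V" "k \<in> V" "br h k \<in> V"
  shows "lie_relator br h k \<in> carrier (free_algebra V)"
  using assms by (auto simp: lie_relator_def intro!: carrier_diff)

lemma J_annihilator_lie_compatible: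
  assumes br: "\<And>h k. h \<in> V \<Longrightarrow> k \<in> V \<Longrightarrow> br h k \<in> V" and \<alpha>: "\<alpha> \<in> J_annihilator V br"
  shows "lie_compatible V br (\<lambda>hs. \<alpha> (tensor V hs))"
  unfolding lie_compatible_def
proof (intro ballI)
  fix us vs h k assume *: "us \<in> lists V" "vs \<in> lists V" "h \<in> V" "k \<in> V"
  let ?S = "{tensor_class V (lie_relator br h k) | h k. h \<in> V \<and> k \<in> V}"
  have J_eq: "J_ideal V br = genideal (tensor_algebra V) ?S"
    by (rule J_ideal_eq) (rule br)
  have S: "?S \<subseteq> carrier (tensor_algebra V)"
    by (auto simp: carrier_tensor_algebra intro!: imageI lie_relator_carrier br)
  interpret J: ideal "J_ideal V br" "tensor_algebra V"
    unfolding J_eq using S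
    by (rule ring.genideal_ideal[OF ring_tensor_algebra])
  define g where "g = lie_relator br h k"
  have gc: "g \<in> carrier (free_algebra V)" unfolding g_def using * by (intro lie_relator_carrier br)
  have "tensor_class V g \<in> J_ideal V br"
    unfolding J_eq g_def
    by (rule set_mp[OF ring.genideal_self[OF ring_tensor_algebra S]]) (use * in blast)
  then have "tensor_class V (word 1 us) \<otimes>\<^bsub>tensor_algebra V\<^esub> tensor_class V g
      \<otimes>\<^bsub>tensor_algebra V\<^esub> tensor_class V (word 1 vs) \<in> J_ideal V br"
    using * by (intro J.I_l_closed J.I_r_closed) (auto simp: carrier_tensor_algebra)
  then have "tensor_class V (word 1 us * g * word 1 vs) \<in> J_ideal V br"
    using * gc by (simp only: tensor_class_mult carrier_mult word_carrier simp_thms)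
  then have "\<alpha> (tensor_class V (word 1 us * g * word 1 vs)) = 0"
    using \<alpha> by (simp add: J_annihilator_def)
  then have "word_eval (\<lambda>hs. \<alpha> (tensor V hs)) (word 1 us * g * word 1 vs) = 0"
    using \<alpha> * gc by (subst tensor_dual_class[symmetric]) (auto simp: J_annihilator_def carrier_mult)
  then show "\<alpha> (tensor V (us @ [h, k] @ vs)) - \<alpha> (tensor V (us @ [k, h] @ vs)) =
       \<alpha> (tensor V (us @ [br h k] @ vs))"
    by (simp add: g_def lie_relator_def word_eval_mult word_eval_diff)
qed

lemma tensor_functional_in_J_annihilator:
  assumes br: "\<And>h k. h \<in> V \<Longrightarrow> k \<in> V \<Longrightarrow> br h k \<in> V"
    and f: "multilinear_on V f" and lie: "lie_compatible V br f"
  shows "tensor_functional V f \<in> J_annihilator V br"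
proof -
  let ?S = "{tensor_class V (lie_relator br h k) | h k. h \<in> V \<and> k \<in> V}"
  have J_eq: "J_ideal V br = genideal (tensor_algebra V) ?S"
    by (rule J_ideal_eq) (rule br)
  have "J_ideal V br \<subseteq> tensor_class V ` kernel_ideal V f"
    unfolding J_eq
  proof (rule ring.genideal_minimal[OF ring_tensor_algebra])
    show "ideal (tensor_class V ` kernel_ideal V f) (tensor_algebra V)"
      using ring.ring_ideal_imp_quot_ideal[OF ring_free_algebra ideal_linearity_ideal ideal_kernel_ideal, of V f]
      by (simp add: tensor_class_def[abs_def] tensor_algebra_def)
    have "lie_relator br h k \<in> kernel_ideal V f" if "h \<in> V" "k \<in> V" for h k
      using that lie lie_relator_carrier[OF that] br[OF that]
      by (auto simp: kernel_ideal_def lie_compatible_def lie_relator_def word_eval_diff)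
    then show "{tensor_class V (lie_relator br h k) | h k. h \<in> V \<and> k \<in> V} \<subseteq> tensor_class V ` kernel_ideal V f"
      by blast
  qed
  moreover have "tensor_functional V f (tensor_class V p) = 0" if "p \<in> kernel_ideal V f" for p
    using that tensor_functional_class[OF f, of p] kernel_ideal_eval[OF that] by (simp add: kernel_ideal_def)
  ultimately show ?thesis
    unfolding J_annihilator_def using tensor_functional_in_dual[OF f] by auto
qed

section \<open>De la Vallee-Poussin means as finite averages over roots of unity\<close>

definition root_of_unity :: "nat \<Rightarrow> nat \<Rightarrow> complex" where
  "root_of_unity M j = cis (2 * pi * real j / real M)"

lemma norm_root_of_unity [simp]: "cmod (root_of_unity M j) = 1"
  by (simp add: root_of_unity_def)

text \<open>The sum is geometric with ratio \<open>w\<close>, a power of the primitive root; \<open>w = 1\<close> would make \<open>M\<close> divide \<open>a - b\<close>.\<close>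
lemma root_of_unity_orthogonality:
  assumes "M > 0" "a < b + M" "b < a + M"
  shows "(\<Sum>j<M. root_of_unity M j ^ a * cnj (root_of_unity M j ^ b)) = (if a = b then of_nat M else 0)"
proof -
  define w where "w = cis (2 * pi * (real a - real b) / real M)"
  have "root_of_unity M j ^ a * cnj (root_of_unity M j ^ b) = w ^ j" for j
    by (simp add: root_of_unity_def w_def Complex.DeMoivre cis_cnj cis_mult algebra_simps diff_divide_distrib
        flip: complex_cnj_power)
  then have eq: "(\<Sum>j<M. root_of_unity M j ^ a * cnj (root_of_unity M j ^ b)) = (\<Sum>j<M. w ^ j)"
    by simp
  show ?thesis
  proof (cases "a = b")
    case False
    have "w \<noteq> 1"
    proof
      assume "w = 1"
      then obtain k :: int where "2 * pi * (real a - real b) / real M = of_int k * 2 * pi"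
        unfolding w_def complex_eq_iff by (auto simp: cos_one_2pi_int)
      then have "2 * pi * ((real a - real b) / real M) = 2 * pi * of_int k" by simp
      then have "(real a - real b) / real M = of_int k"
        unfolding mult_cancel_left by simp
      then have "real a - real b = of_int k * real M"
        using assms(1) by (simp add: divide_eq_eq)
      then have "real_of_int (int a - int b) = real_of_int (k * int M)" by simp
      then have k: "int a - int b = k * int M" by linarith
      have "\<bar>int a - int b\<bar> < int M" using assms by linarith
      then have "\<bar>k\<bar> * int M < 1 * int M" unfolding k by (simp only: abs_mult abs_of_nat mult_1)
      then have "k = 0" using assms(1) by (simp add: mult_less_cancel_right)
      with k False show False by simp
    qed
    moreover have "w ^ M = cis (2 * pi * of_int (int a - int b))"
      using assms(1) by (simp add: w_def Complex.DeMoivre)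
    then have "w ^ M = 1" by (simp only: cis_multiple_2pi Ints_of_int)
    ultimately show ?thesis using False eq by (simp add: geometric_sum)
  qed (use eq in \<open>simp add: w_def\<close>)
qed

text \<open>The Fejer kernel \<open>\<bar>1 + z + \<dots> + z\<^sup>N\<^sup>-\<^sup>1\<bar>\<^sup>2 / N\<close> at the \<open>M\<close>-th roots of unity, normalised to a
  probability weight. A discrete kernel suffices, because it is only paired with
  polynomials of bounded degree; this keeps all averages finite.\<close>
definition fejer_weight :: "nat \<Rightarrow> nat \<Rightarrow> nat \<Rightarrow> real" where
  "fejer_weight N M j = (cmod (\<Sum>k<N. root_of_unity M j ^ k))\<^sup>2 / (real N * real M)"

text \<open>Expanding the square, orthogonality leaves the pairs \<open>k, l < N\<close> with \<open>k + m = l\<close>, of which there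
  are \<open>N - m\<close> (truncated at \<open>0\<close>). The bound on \<open>M\<close> excludes aliasing, that is, \<open>k + m\<close> and \<open>l\<close>
  that differ by a nonzero multiple of \<open>M\<close>.\<close>
lemma fejer_weight_moment:
  assumes "N > 0" "N + m \<le> M"
  shows "(\<Sum>j<M. fejer_weight N M j * root_of_unity M j ^ m) = of_real (real (N - m) / real N)"
proof -
  let ?z = "root_of_unity M"
  have M: "M > 0" using assms by simp
  have "of_real ((cmod (\<Sum>k<N. ?z j ^ k))\<^sup>2) * ?z j ^ m =
      (\<Sum>k<N. \<Sum>l<N. ?z j ^ (k + m) * cnj (?z j ^ l))" for j
  proof -
    have "of_real ((cmod (\<Sum>k<N. ?z j ^ k))\<^sup>2) * ?z j ^ m =
        (\<Sum>k<N. ?z j ^ k) * (\<Sum>l<N. cnj (?z j ^ l)) * ?z j ^ m"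
      by (simp only: complex_norm_square cnj_sum)
    also have "\<dots> = (\<Sum>k<N. \<Sum>l<N. ?z j ^ (k + m) * cnj (?z j ^ l))"
      by (subst sum_product) (simp add: sum_distrib_right sum_distrib_left power_add mult_ac)
    finally show ?thesis .
  qed
  then have "(\<Sum>j<M. of_real ((cmod (\<Sum>k<N. ?z j ^ k))\<^sup>2) * ?z j ^ m) =
      (\<Sum>j<M. \<Sum>k<N. \<Sum>l<N. ?z j ^ (k + m) * cnj (?z j ^ l))" by simp
  also have "\<dots> = (\<Sum>k<N. \<Sum>l<N. \<Sum>j<M. ?z j ^ (k + m) * cnj (?z j ^ l))"
    by (subst sum.swap, rule sum.cong[OF refl], rule sum.swap)
  also have "\<dots> = (\<Sum>k<N. \<Sum>l<N. if k + m = l then of_nat M else 0)"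
    using assms M by (intro sum.cong refl root_of_unity_orthogonality) auto
  also have "\<dots> = (\<Sum>k<N. if k < N - m then of_nat M else 0)"
    by (intro sum.cong refl) auto
  also have "\<dots> = (\<Sum>k\<in>{k \<in> {..<N}. k < N - m}. of_nat M)"
    by (rule sum.inter_filter[symmetric]) simp
  also have "{k \<in> {..<N}. k < N - m} = {..<N - m}" by auto
  finally have "(\<Sum>j<M. of_real ((cmod (\<Sum>k<N. ?z j ^ k))\<^sup>2) * ?z j ^ m) = of_nat (N - m) * of_nat M"
    by simp
  moreover have "(\<Sum>j<M. fejer_weight N M j * ?z j ^ m) =
      (\<Sum>j<M. of_real ((cmod (\<Sum>k<N. ?z j ^ k))\<^sup>2) * ?z j ^ m) / (of_nat N * of_nat M)"
    by (simp add: fejer_weight_def sum_divide_distrib)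
  ultimately show ?thesis using M by simp
qed

lemma fejer_weight_nonneg: "fejer_weight N M j \<ge> 0"
  by (simp add: fejer_weight_def)

lemma sum_fejer_weight:
  assumes "N > 0" "N \<le> M"
  shows "(\<Sum>j<M. fejer_weight N M j) = 1"
proof -
  have "complex_of_real (\<Sum>j<M. fejer_weight N M j) = 1"
    using fejer_weight_moment[of N 0 M] assms by simp
  then show ?thesis by (simp only: of_real_eq_1_iff)
qed

text \<open>On weights up to \<open>d\<close>, the sequence \<open>c\<close> consists of the moments of a finitely supported measure
  on the unit circle of total mass at most \<open>C\<close>. Multiplying Fourier coefficients by \<open>c\<close> then amounts to averaging over
  rotations, and costs at most the factor \<open>C\<close> in any rotation invariant norm.\<close>
definition bounded_multiplier :: "real \<Rightarrow> nat \<Rightarrow> (nat \<Rightarrow> complex) \<Rightarrow> bool" where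
  "bounded_multiplier C d c \<longleftrightarrow> (\<exists>(M::nat) \<kappa> z. (\<forall>j<M. cmod (z j) = 1) \<and>
     (\<forall>m\<le>d. c m = (\<Sum>j<M. \<kappa> j * z j ^ m)) \<and> (\<Sum>j<M. cmod (\<kappa> j)) \<le> C)"

text \<open>The Fejer multiplier of order \<open>2 N\<close> doubled, minus that of order \<open>N\<close>. The linear terms
  cancel for \<open>m \<le> N\<close>, which leaves the constant \<open>1\<close> there.\<close>
definition vallee_poussin :: "nat \<Rightarrow> nat \<Rightarrow> complex" where
  "vallee_poussin N m = of_real (2 * (real (2 * N - m) / real (2 * N)) - real (N - m) / real N)"

lemma vallee_poussin_eq_1: "N > 0 \<Longrightarrow> m \<le> N \<Longrightarrow> vallee_poussin N m = 1"
  by (simp add: vallee_poussin_def field_simps of_nat_diff flip: of_real_diff)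

lemma vallee_poussin_eq_0: "2 * N \<le> m \<Longrightarrow> vallee_poussin N m = 0"
  by (simp add: vallee_poussin_def)

lemma bounded_multiplier_vallee_poussin:
  assumes N: "N > 0"
  shows "bounded_multiplier 3 d (vallee_poussin N)"
proof -
  define M where "M = 2 * N + d"
  define \<kappa> where "\<kappa> j = 2 * fejer_weight (2 * N) M j - fejer_weight N M j" for j
  have "vallee_poussin N m = (\<Sum>j<M. of_real (\<kappa> j) * root_of_unity M j ^ m)" if "m \<le> d" for m
  proof -
    have "(\<Sum>j<M. of_real (\<kappa> j) * root_of_unity M j ^ m) =
        2 * (\<Sum>j<M. fejer_weight (2 * N) M j * root_of_unity M j ^ m) -
        (\<Sum>j<M. fejer_weight N M j * root_of_unity M j ^ m)"
      by (simp add: \<kappa>_def sum_subtractf sum_distrib_left algebra_simps)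
    then show ?thesis
      using N that by (simp add: fejer_weight_moment M_def vallee_poussin_def)
  qed
  moreover have "(\<Sum>j<M. cmod (of_real (\<kappa> j))) \<le> 3"
  proof -
    have "(\<Sum>j<M. cmod (of_real (\<kappa> j))) \<le> (\<Sum>j<M. 2 * fejer_weight (2 * N) M j + fejer_weight N M j)"
    proof (rule sum_mono)
      fix j
      show "cmod (of_real (\<kappa> j)) \<le> 2 * fejer_weight (2 * N) M j + fejer_weight N M j"
        unfolding norm_of_real \<kappa>_def
        using fejer_weight_nonneg[of "2 * N" M j] fejer_weight_nonneg[of N M j] by linarith
    qed
    also have "\<dots> = 3"
      using N by (simp add: sum.distrib sum_fejer_weight M_def flip: sum_distrib_left)
    finally show ?thesis .
  qed
  ultimately show ?thesis
    unfolding bounded_multiplier_def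
    by (intro exI[of _ M] exI[of _ "\<lambda>j. of_real (\<kappa> j)"] exI[of _ "root_of_unity M"]) simp
qed

text \<open>The constant sequence \<open>1\<close> has all its mass at the point \<open>1\<close> of the circle.\<close>
lemma bounded_multiplier_complement:
  assumes "bounded_multiplier C d c"
  shows "bounded_multiplier (C + 1) d (\<lambda>m. 1 - c m)"
proof -
  obtain M :: nat and \<kappa> z where *: "\<And>j. j < M \<Longrightarrow> cmod (z j) = 1"
      "\<And>m. m \<le> d \<Longrightarrow> c m = (\<Sum>j<M. \<kappa> j * z j ^ m)" "(\<Sum>j<M. cmod (\<kappa> j)) \<le> C"
    using assms unfolding bounded_multiplier_def by blast
  define \<kappa>' where "\<kappa>' j = (if j < M then - \<kappa> j else 1)" for j
  define z' where "z' j = (if j < M then z j else 1)" for j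
  show ?thesis
    unfolding bounded_multiplier_def
    by (intro exI[of _ "Suc M"] exI[of _ \<kappa>'] exI[of _ z'])
      (use * in \<open>auto simp: \<kappa>'_def z'_def sum_negf less_Suc_eq\<close>)
qed

section \<open>Dilations and the weight decomposition\<close>

lemma infinite_unit_circle: "infinite {z. cmod z = 1}"
proof
  assume "finite {z. cmod z = 1}"
  moreover have "cis ` {0..1} \<subseteq> {z. cmod z = 1}" by auto
  moreover have "inj_on cis {0..1}"
  proof (rule inj_onI)
    fix x y :: real assume *: "x \<in> {0..1}" "y \<in> {0..1}" "cis x = cis y"
    have "0 \<le> x" "x \<le> pi" "0 \<le> y" "y \<le> pi" using *(1,2) pi_gt3 by auto
    moreover from arg_cong[OF *(3), of Re] have "cos x = cos y" by simp
    ultimately show "x = y" by (rule cos_inj_pi)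
  qed
  ultimately have "finite {0..1::real}" by (meson finite_subset finite_imageD)
  then show False using infinite_Icc[of "0::real" 1] by simp
qed

lemma poly_eqI_unit_circle:
  fixes p r :: "complex poly"
  assumes "\<And>z. cmod z = 1 \<Longrightarrow> poly p z = poly r z"
  shows "p = r"
proof (rule ccontr)
  assume "p \<noteq> r"
  then have "finite {z. poly (p - r) z = 0}" by (intro poly_roots_finite) simp
  moreover have "{z. cmod z = 1} \<subseteq> {z. poly (p - r) z = 0}" using assms by auto
  ultimately show False using infinite_unit_circle finite_subset by blast
qed

text \<open>The second component has weight \<open>2\<close> because it contains the brackets of elements of weight \<open>1\<close>.\<close>
definition dilation :: "complex \<Rightarrow> 'w::complex_vector \<times> 'c::complex_vector \<Rightarrow> 'w \<times> 'c" where
  "dilation z h = (z *\<^sub>C fst h, z\<^sup>2 *\<^sub>C snd h)"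

lemmas module_scaleC = module_iff_vector_space[THEN iffD2, OF vector_space_scaleC]

lemma scaleC_one [simp]: "1 *\<^sub>C x = (x :: 'a::complex_vector)"
  using module.scale_one[OF module_scaleC] .

lemma scaleC_zero [simp]: "c *\<^sub>C 0 = (0 :: 'a::complex_vector)"
  using module.scale_zero_right[OF module_scaleC] .

lemma scaleC_minus: "c *\<^sub>C (x - y) = c *\<^sub>C x - c *\<^sub>C (y :: 'a::complex_vector)"
  using module.scale_right_diff_distrib[OF module_scaleC] .

lemma scaleC_left_commute: "c *\<^sub>C d *\<^sub>C x = d *\<^sub>C c *\<^sub>C (x :: 'a::complex_vector)"
  by (simp add: scaleC_scaleC mult.commute)

lemma dilation_add: "dilation z (h + k) = dilation z h + dilation z k"
  by (simp add: dilation_def scaleC_add_right)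

lemma dilation_scaleC: "dilation z (c *\<^sub>C h) = c *\<^sub>C dilation z h"
  by (simp add: dilation_def scaleC_prod_def scaleC_left_commute)

lemma dilation_one [simp]: "dilation 1 = id"
  by (simp add: dilation_def fun_eq_iff)

text \<open>Dilating a letter \<open>(x, y)\<close> and splitting it only forms combinations of \<open>(x, 0)\<close>, \<open>(0, y)\<close> and \<open>0\<close>
  with unimodular coefficients; the conditions on \<open>S\<close> keep these inside \<open>S \<times> UNIV\<close>, the set of letters.\<close>
locale graded_functional =
  fixes S :: "'w::complex_vector set"
    and f :: "('w \<times> 'c::complex_vector) list \<Rightarrow> complex"
  assumes zero_mem: "0 \<in> S"
    and circled: "cmod z = 1 \<Longrightarrow> x \<in> S \<Longrightarrow> z *\<^sub>C x \<in> S"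
    and multilinear: "multilinear_on (S \<times> UNIV) f"
begin

lemma dilation_mem: "cmod z = 1 \<Longrightarrow> h \<in> S \<times> UNIV \<Longrightarrow> dilation z h \<in> S \<times> UNIV"
  by (auto simp: dilation_def circled)

lemma map_dilation_mem: "cmod z = 1 \<Longrightarrow> hs \<in> lists (S \<times> UNIV) \<Longrightarrow> map (dilation z) hs \<in> lists (S \<times> UNIV)"
  unfolding in_lists_conv_set set_map by (blast intro: dilation_mem)

lemma multilinearD:
  assumes "us \<in> lists (S \<times> UNIV)" "vs \<in> lists (S \<times> UNIV)" "h \<in> S \<times> UNIV" "k \<in> S \<times> UNIV" "c *\<^sub>C h + k \<in> S \<times> UNIV"
  shows "f (us @ (c *\<^sub>C h + k) # vs) = c * f (us @ h # vs) + f (us @ k # vs)"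
  using multilinear[unfolded multilinear_on_def, rule_format, OF assms] by simp

lemma zero_letter:
  assumes "us \<in> lists (S \<times> UNIV)" "vs \<in> lists (S \<times> UNIV)"
  shows "f (us @ 0 # vs) = 0"
  using multilinearD[OF assms, of 0 0 1] zero_mem by (simp add: zero_prod_def)

lemma split_dilated_letter:
  assumes "us \<in> lists (S \<times> UNIV)" "vs \<in> lists (S \<times> UNIV)" "x \<in> S" "cmod z = 1"
  shows "f (us @ dilation z (x, y) # vs) = z\<^sup>2 * f (us @ (0, y) # vs) + z * f (us @ (x, 0) # vs)"
proof -
  have "dilation z (x, y) = z\<^sup>2 *\<^sub>C (0, y) + (z *\<^sub>C (x, 0) + 0)"
    by (simp add: dilation_def scaleC_prod_def)
  moreover have "z *\<^sub>C (x, 0::'c) + 0 \<in> S \<times> UNIV"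
    using circled assms by (simp add: scaleC_prod_def)
  ultimately show ?thesis
    using multilinearD[OF assms(1,2), of "(0, y)" "z *\<^sub>C (x, 0) + 0" "z\<^sup>2"]
      multilinearD[OF assms(1,2), of "(x, 0)" 0 z] zero_letter[OF assms(1,2)]
      assms circled[of z x] zero_mem
    by (simp add: scaleC_prod_def zero_prod_def)
qed

text \<open>Splitting each letter into its two components expands \<open>f\<close> into \<open>2\<^sup>n\<close> terms, and each letter
  contributes a factor \<open>z\<close> or \<open>z\<^sup>2\<close>. The prefix \<open>us\<close>, which is not dilated, carries the letters already split.\<close>
lemma weight_expansion:
  assumes "us \<in> lists (S \<times> UNIV)" "hs \<in> lists (S \<times> UNIV)"
  shows "\<exists>p. degree p \<le> 2 * length hs \<and> (\<forall>m<length hs. coeff p m = 0) \<and>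
    (\<forall>z. cmod z = 1 \<longrightarrow> poly p z = f (us @ map (dilation z) hs))"
  using assms(2,1)
proof (induction hs arbitrary: us rule: lists.induct)
  case Nil
  show ?case by (rule exI[of _ "[:f us:]"]) simp
next
  case (Cons h hs)
  obtain x y where h: "h = (x, y)" "x \<in> S" using Cons.hyps by auto
  obtain p1 where p1: "degree p1 \<le> 2 * length hs" "\<And>m. m < length hs \<Longrightarrow> coeff p1 m = 0"
      "\<And>z. cmod z = 1 \<Longrightarrow> poly p1 z = f (us @ (x, 0) # map (dilation z) hs)"
    using Cons.IH[of "us @ [(x, 0)]"] Cons.prems h(2) by auto
  obtain p2 where p2: "degree p2 \<le> 2 * length hs" "\<And>m. m < length hs \<Longrightarrow> coeff p2 m = 0"
      "\<And>z. cmod z = 1 \<Longrightarrow> poly p2 z = f (us @ (0, y) # map (dilation z) hs)"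
    using Cons.IH[of "us @ [(0, y)]"] Cons.prems zero_mem by auto
  define p where "p = pCons 0 (p1 + pCons 0 p2)"
  have "degree p \<le> 2 * length (h # hs)"
  proof -
    have "degree (p1 + pCons 0 p2) \<le> Suc (2 * length hs)"
      using p1(1) p2(1) degree_pCons_le[of 0 p2] by (intro degree_add_le) auto
    then show ?thesis using degree_pCons_le[of 0 "p1 + pCons 0 p2"] by (simp add: p_def)
  qed
  moreover have "coeff p m = 0" if "m < length (h # hs)" for m
    using that p1(2) p2(2) by (auto simp: p_def coeff_pCons split: nat.split)
  moreover have "poly p z = f (us @ map (dilation z) (h # hs))" if "cmod z = 1" for z
    using split_dilated_letter[OF Cons.prems map_dilation_mem[OF that Cons.hyps(2)] h(2) that, of y]
      p1(3)[OF that] p2(3)[OF that]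
    by (simp add: p_def h(1) power2_eq_square algebra_simps)
  ultimately show ?case by blast
qed

text \<open>The polynomial is unique because the unit circle is infinite. Its \<open>m\<close>-th coefficient is the component of \<open>f\<close>
  of weight \<open>m\<close>.\<close>
definition weight_poly :: "('w \<times> 'c) list \<Rightarrow> complex poly" where
  "weight_poly hs = (THE p. \<forall>z. cmod z = 1 \<longrightarrow> poly p z = f (map (dilation z) hs))"

lemma weight_poly_eqI:
  assumes "\<And>z. cmod z = 1 \<Longrightarrow> poly p z = f (map (dilation z) hs)"
  shows "weight_poly hs = p"
  unfolding weight_poly_def
  by (rule the_equality) (use assms in \<open>auto intro!: poly_eqI_unit_circle\<close>)

lemma
  assumes "hs \<in> lists (S \<times> UNIV)"
  shows degree_weight_poly: "degree (weight_poly hs) \<le> 2 * length hs"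
    and coeff_weight_poly_low: "m < length hs \<Longrightarrow> coeff (weight_poly hs) m = 0"
    and poly_weight_poly: "cmod z = 1 \<Longrightarrow> poly (weight_poly hs) z = f (map (dilation z) hs)"
proof -
  obtain p where p: "degree p \<le> 2 * length hs" "\<And>m. m < length hs \<Longrightarrow> coeff p m = 0"
      "\<And>z. cmod z = 1 \<Longrightarrow> poly p z = f (map (dilation z) hs)"
    using weight_expansion[OF lists.Nil assms] by auto
  then have "weight_poly hs = p" by (intro weight_poly_eqI)
  with p show "degree (weight_poly hs) \<le> 2 * length hs"
    "m < length hs \<Longrightarrow> coeff (weight_poly hs) m = 0"
    "cmod z = 1 \<Longrightarrow> poly (weight_poly hs) z = f (map (dilation z) hs)" by auto
qed

definition reweight :: "(nat \<Rightarrow> complex) \<Rightarrow> ('w \<times> 'c) list \<Rightarrow> complex" where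
  "reweight c hs = (\<Sum>m\<le>degree (weight_poly hs). c m * coeff (weight_poly hs) m)"

lemma reweight_eq:
  assumes "degree (weight_poly hs) \<le> D"
  shows "reweight c hs = (\<Sum>m\<le>D. c m * coeff (weight_poly hs) m)"
  unfolding reweight_def using assms
  by (intro sum.mono_neutral_left) (auto simp: coeff_eq_0)

text \<open>Reweighting by the moments of a measure on the circle is averaging over dilations.\<close>
lemma reweight_average:
  assumes hs: "hs \<in> lists (S \<times> UNIV)" and z: "\<And>j. j < M \<Longrightarrow> cmod (z j) = 1"
    and c: "\<And>m. m \<le> 2 * length hs \<Longrightarrow> c m = (\<Sum>j<(M::nat). \<kappa> j * z j ^ m)"
  shows "reweight c hs = (\<Sum>j<M. \<kappa> j * f (map (dilation (z j)) hs))"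
proof -
  let ?p = "weight_poly hs"
  have "reweight c hs = (\<Sum>m\<le>degree ?p. \<Sum>j<M. \<kappa> j * z j ^ m * coeff ?p m)"
    unfolding reweight_def using c degree_weight_poly[OF hs] by (simp add: sum_distrib_right)
  also have "\<dots> = (\<Sum>j<M. \<kappa> j * poly ?p (z j))"
    by (subst sum.swap) (simp add: poly_altdef sum_distrib_left mult_ac)
  also have "\<dots> = (\<Sum>j<M. \<kappa> j * f (map (dilation (z j)) hs))"
    using z poly_weight_poly[OF hs] by simp
  finally show ?thesis .
qed

lemma reweight_complement:
  assumes "hs \<in> lists (S \<times> UNIV)"
  shows "reweight (\<lambda>m. 1 - c m) hs = f hs - reweight c hs"
proof -
  have "f hs = poly (weight_poly hs) 1"
    using poly_weight_poly[OF assms, of 1] by simp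
  then show ?thesis
    by (simp add: reweight_def poly_altdef left_diff_distrib sum_subtractf)
qed

text \<open>Words of length \<open>n\<close> only have components of weights \<open>n\<close> to \<open>2 n\<close>.\<close>
lemma reweight_eq_0:
  assumes "hs \<in> lists (S \<times> UNIV)" and "\<And>m. length hs \<le> m \<Longrightarrow> m \<le> 2 * length hs \<Longrightarrow> c m = 0"
  shows "reweight c hs = 0"
  unfolding reweight_def
proof (rule sum.neutral, safe)
  fix m assume "m \<le> degree (weight_poly hs)"
  then show "c m * coeff (weight_poly hs) m = 0"
    using assms degree_weight_poly[of hs] coeff_weight_poly_low[of hs m] by (cases "m < length hs") auto
qed

text \<open>Dilations are linear, so the polynomial inherits every linear relation that \<open>f\<close> satisfies, and
  its coefficients inherit it in turn. The same argument gives the Lie relations.\<close>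
lemma multilinear_reweight: "multilinear_on (S \<times> UNIV) (reweight c)"
  unfolding multilinear_on_def
proof (intro ballI allI impI)
  fix us vs :: "('w \<times> 'c) list" and h k :: "'w \<times> 'c" and a
  assume *: "us \<in> lists (S \<times> UNIV)" "vs \<in> lists (S \<times> UNIV)"
    "h \<in> S \<times> UNIV" "k \<in> S \<times> UNIV" "a *\<^sub>C h + k \<in> S \<times> UNIV"
  let ?w = "\<lambda>x. us @ [x] @ vs"
  have mem: "?w x \<in> lists (S \<times> UNIV)" if "x \<in> S \<times> UNIV" for x using * that by simp
  have wp: "weight_poly (?w (a *\<^sub>C h + k)) = smult a (weight_poly (?w h)) + weight_poly (?w k)"
  proof (rule weight_poly_eqI)
    fix z :: complex assume z: "cmod z = 1"
    have "dilation z (a *\<^sub>C h + k) \<in> S \<times> UNIV" using dilation_mem[OF z *(5)] .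
    then show "poly (smult a (weight_poly (?w h)) + weight_poly (?w k)) z = f (map (dilation z) (?w (a *\<^sub>C h + k)))"
      using poly_weight_poly[OF mem[OF *(3)] z] poly_weight_poly[OF mem[OF *(4)] z]
        multilinearD[OF map_dilation_mem[OF z *(1)] map_dilation_mem[OF z *(2)] dilation_mem[OF z *(3)] dilation_mem[OF z *(4)], of a]
      by (simp add: dilation_add dilation_scaleC)
  qed
  define D where "D = 2 * length (?w h)"
  have "reweight c (?w x) = (\<Sum>m\<le>D. c m * coeff (weight_poly (?w x)) m)" if "x \<in> S \<times> UNIV" for x
    using degree_weight_poly[OF mem[OF that]] by (intro reweight_eq) (simp add: D_def)
  then show "reweight c (?w (a *\<^sub>C h + k)) = a * reweight c (?w h) + reweight c (?w k)"
    using * wp by (simp add: sum.distrib sum_distrib_left algebra_simps)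
qed

lemma lie_compatible_reweight:
  assumes lie: "lie_compatible (S \<times> UNIV) br f"
    and br_mem: "\<And>h k. h \<in> S \<times> UNIV \<Longrightarrow> k \<in> S \<times> UNIV \<Longrightarrow> br h k \<in> S \<times> UNIV"
    and br: "\<And>z h k. br (dilation z h) (dilation z k) = dilation z (br h k)"
  shows "lie_compatible (S \<times> UNIV) br (reweight c)"
  unfolding lie_compatible_def
proof (intro ballI)
  fix us vs :: "('w \<times> 'c) list" and h k :: "'w \<times> 'c"
  assume *: "us \<in> lists (S \<times> UNIV)" "vs \<in> lists (S \<times> UNIV)" "h \<in> S \<times> UNIV" "k \<in> S \<times> UNIV"
  let ?w = "\<lambda>xs. us @ xs @ vs"
  have mem: "?w xs \<in> lists (S \<times> UNIV)" if "xs \<in> {[h, k], [k, h], [br h k]}" for xs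
    using that * br_mem[OF *(3,4)] unfolding insert_iff empty_iff by (elim disjE) simp_all
  have "weight_poly (?w [h, k]) - weight_poly (?w [k, h]) = weight_poly (?w [br h k])"
  proof (rule poly_eqI_unit_circle)
    fix z :: complex assume z: "cmod z = 1"
    show "poly (weight_poly (?w [h, k]) - weight_poly (?w [k, h])) z = poly (weight_poly (?w [br h k])) z"
      using lie[unfolded lie_compatible_def, rule_format, OF map_dilation_mem[OF z *(1)]
          map_dilation_mem[OF z *(2)] dilation_mem[OF z *(3)] dilation_mem[OF z *(4)]]
        poly_weight_poly[OF mem[of "[h, k]"] z] poly_weight_poly[OF mem[of "[k, h]"] z]
        poly_weight_poly[OF mem[of "[br h k]"] z]
      by (simp add: br)
  qed
  then have wp: "coeff (weight_poly (?w [br h k])) m =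
      coeff (weight_poly (?w [h, k])) m - coeff (weight_poly (?w [k, h])) m" for m
    by (metis coeff_diff)
  define D where "D = 2 * length (?w [h, k])"
  have rw: "reweight c (?w xs) = (\<Sum>m\<le>D. c m * coeff (weight_poly (?w xs)) m)"
    if "xs \<in> {[h, k], [k, h], [br h k]}" for xs
    using degree_weight_poly[OF mem[OF that]] that by (intro reweight_eq) (auto simp: D_def)
  show "reweight c (?w [h, k]) - reweight c (?w [k, h]) = reweight c (?w [br h k])"
    using rw[of "[h, k]"] rw[of "[k, h]"] rw[of "[br h k]"] wp
    by (simp add: sum_subtractf right_diff_distrib)
qed

end

section \<open>Rotation invariance of the Cameron--Martin structure\<close>

lemma scaleC_scaleR: "c *\<^sub>C r *\<^sub>R x = r *\<^sub>R c *\<^sub>C (x :: 'a::complex_vector)"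
  by (simp add: scaleC_left_commute flip: scaleC_of_real)

lemma bounded_linear_scaleC: "bounded_linear (\<lambda>w::'w::complex_normed_vector. z *\<^sub>C w)"
  by (rule bounded_linear_intro[where K = "cmod z"])
    (simp_all add: scaleC_add_right scaleC_scaleR norm_scaleC mult.commute)

lift_definition precompose_scaleC :: "complex \<Rightarrow> ('w::complex_normed_vector \<Rightarrow>\<^sub>L real) \<Rightarrow> 'w \<Rightarrow>\<^sub>L real"
  is "\<lambda>z u w. u (z *\<^sub>C w)"
  by (rule bounded_linear_compose[OF _ bounded_linear_scaleC])

context complex_abstract_wiener_space
begin

text \<open>The two sides are the variances of the Gaussian random variables \<open>u (\<i> w)\<close> and \<open>u w\<close>,
  which have the same law.\<close>
lemma q_precompose_i: "q (precompose_scaleC \<i> u) (precompose_scaleC \<i> u) = q u u"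
proof -
  let ?e = "\<lambda>w. exp (\<i> * complex_of_real (blinfun_apply u w))"
  have "exp (- complex_of_real (q (precompose_scaleC \<i> u) (precompose_scaleC \<i> u)) / 2) =
      (\<integral>w. ?e (\<i> *\<^sub>C w) \<partial>\<mu>)"
    using characteristic_function[of "precompose_scaleC \<i> u"] by (simp add: precompose_scaleC.rep_eq)
  also have "\<dots> = (\<integral>w. ?e w \<partial>distr \<mu> \<mu> (\<lambda>w. \<i> *\<^sub>C w))"
  proof (rule integral_distr[symmetric])
    show "(\<lambda>w. \<i> *\<^sub>C w) \<in> measurable \<mu> \<mu>"
      unfolding measurable_cong_sets[OF sets_eq_borel sets_eq_borel]
      by (intro borel_measurable_continuous_onI bounded_linear.continuous_on[OF bounded_linear_scaleC] continuous_on_id)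
    show "?e \<in> borel_measurable \<mu>"
      unfolding measurable_cong_sets[OF sets_eq_borel refl]
      by (intro borel_measurable_continuous_onI continuous_intros)
  qed
  also have "\<dots> = exp (- complex_of_real (q u u) / 2)"
    by (simp only: invariant_under_i characteristic_function)
  finally have "exp (complex_of_real (- q (precompose_scaleC \<i> u) (precompose_scaleC \<i> u) / 2)) =
      exp (complex_of_real (- q u u / 2))" by simp
  then show ?thesis by (simp only: exp_of_real of_real_eq_iff exp_inj_iff)
qed

text \<open>Invariance under \<open>\<i>\<close> extends to the circle: applied to \<open>u + u \<circ> \<i>\<close> it shows that \<open>u\<close> and
  \<open>u \<circ> \<i>\<close> are \<open>q\<close>-orthogonal, and \<open>u \<circ> z = Re z u + Im z (u \<circ> \<i>)\<close>.\<close>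
lemma q_precompose:
  "q (precompose_scaleC z u) (precompose_scaleC z u) = (cmod z)\<^sup>2 * q u u"
proof -
  let ?v = "precompose_scaleC \<i> u"
  note bil = bilinear_ladd[OF q_bilinear] bilinear_radd[OF q_bilinear] bilinear_lsub[OF q_bilinear]
    bilinear_rsub[OF q_bilinear] bilinear_lmul[OF q_bilinear] bilinear_rmul[OF q_bilinear]
  have "precompose_scaleC \<i> (u + ?v) = ?v - u"
  proof (rule blinfun_eqI)
    fix w :: 'w
    have "\<i> *\<^sub>C \<i> *\<^sub>C w = (-1) *\<^sub>R w"
      using scaleC_of_real[of "-1" w] by (simp add: scaleC_scaleC)
    then show "blinfun_apply (precompose_scaleC \<i> (u + ?v)) w = blinfun_apply (?v - u) w"
      by (simp add: precompose_scaleC.rep_eq blinfun.bilinear_simps)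
  qed
  then have "q (u + ?v) (u + ?v) = q (?v - u) (?v - u)"
    using q_precompose_i[of "u + ?v"] by simp
  then have orth: "q u ?v = 0" by (simp add: bil q_sym[of ?v u])
  have "precompose_scaleC z u = Re z *\<^sub>R u + Im z *\<^sub>R ?v"
  proof (rule blinfun_eqI)
    fix w :: 'w
    have "z *\<^sub>C w = complex_of_real (Re z) *\<^sub>C w + complex_of_real (Im z) *\<^sub>C \<i> *\<^sub>C w"
      unfolding scaleC_scaleC scaleC_add_left[symmetric] by (simp add: complex_eq[symmetric] mult.commute)
    then show "blinfun_apply (precompose_scaleC z u) w = blinfun_apply (Re z *\<^sub>R u + Im z *\<^sub>R ?v) w"
      by (simp add: precompose_scaleC.rep_eq blinfun.bilinear_simps scaleC_of_real)
  qed
  then have "q (precompose_scaleC z u) (precompose_scaleC z u) = (Re z)\<^sup>2 * q u u + (Im z)\<^sup>2 * q u u"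
    by (simp add: bil orth q_sym[of ?v u] q_precompose_i power2_eq_square)
  then show ?thesis by (simp add: cmod_power2 distrib_right)
qed

lemma cm_norm_scaleC_le:
  assumes "cmod z = 1"
  shows "cm_norm q (z *\<^sub>C w) \<le> cm_norm q w"
  unfolding cm_norm_def
proof (rule SUP_least)
  fix u assume u: "u \<in> (UNIV :: ('w \<Rightarrow>\<^sub>L real) set) - {0}"
  let ?v = "precompose_scaleC z u"
  have q: "q ?v ?v = q u u" using assms by (simp add: q_precompose)
  then have "?v \<noteq> 0" using q_pos[of u] u bilinear_lzero[OF q_bilinear] by auto
  then have "ennreal (\<bar>blinfun_apply ?v w\<bar> / sqrt (q ?v ?v)) \<le>
      (SUP u\<in>UNIV - {0}. ennreal (\<bar>blinfun_apply u w\<bar> / sqrt (q u u)))"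
    by (intro SUP_upper) simp
  then show "ennreal (\<bar>blinfun_apply u (z *\<^sub>C w)\<bar> / sqrt (q u u)) \<le>
      (SUP u\<in>UNIV - {0}. ennreal (\<bar>blinfun_apply u w\<bar> / sqrt (q u u)))"
    by (simp add: q precompose_scaleC.rep_eq)
qed

lemma cm_norm_scaleC:
  assumes "cmod z = 1"
  shows "cm_norm q (z *\<^sub>C w) = cm_norm q w"
proof (rule antisym[OF cm_norm_scaleC_le[OF assms]])
  have "z \<noteq> 0" using assms by auto
  moreover have "cmod (inverse z) = 1" using assms by (simp add: norm_inverse)
  ultimately show "cm_norm q w \<le> cm_norm q (z *\<^sub>C w)"
    using cm_norm_scaleC_le[of "inverse z" "z *\<^sub>C w"] by (simp add: scaleC_scaleC)
qed

lemma zero_in_cm_space: "0 \<in> cm_space q"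
proof -
  have "cm_norm q 0 \<le> 0"
    unfolding cm_norm_def by (rule SUP_least) (simp add: blinfun.bilinear_simps)
  then show ?thesis by (simp add: cm_space_def)
qed

lemma scaleC_in_cm_space: "cmod z = 1 \<Longrightarrow> x \<in> cm_space q \<Longrightarrow> z *\<^sub>C x \<in> cm_space q"
  by (simp add: cm_space_def cm_norm_scaleC)

text \<open>By polarization this only uses the invariance of the norm.\<close>
lemma cm_inner_scaleC:
  assumes "cmod z = 1"
  shows "cm_inner q (z *\<^sub>C x) (z *\<^sub>C y) = cm_inner q x y"
  by (simp add: cm_inner_def Let_def scaleC_left_commute[of \<i> z] cm_norm_scaleC[OF assms]
      flip: scaleC_add_right scaleC_minus)

lemma g_inner_dilation:
  fixes x y :: "'w \<times> 'c::complex_inner"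
  assumes "cmod z = 1"
  shows "g_inner q (dilation z x) (dilation z y) = g_inner q x y"
proof -
  have "z\<^sup>2 * cnj (z\<^sup>2) = 1"
    using assms complex_norm_square[of "z\<^sup>2"] by (simp add: norm_power)
  moreover have "cinner (c *\<^sub>C a) (c *\<^sub>C b) = (c * cnj c) * cinner a b" for c and a b :: 'c
    using cinner_commute[of a "c *\<^sub>C b"] cinner_commute[of b a]
    by (simp add: cinner_scaleC_left)
  ultimately show ?thesis
    by (simp add: g_inner_def dilation_def cm_inner_scaleC[OF assms])
qed

lemma dilation_in_g_CM: "cmod z = 1 \<Longrightarrow> h \<in> g_CM q \<Longrightarrow> dilation z h \<in> g_CM q"
  by (auto simp: g_CM_def dilation_def scaleC_in_cm_space)

text \<open>The supremum over all orthonormal bases that defines the degree norm is therefore invariant under unimodular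
  dilations.\<close>
lemma orthonormal_bases_dilation:
  fixes \<Gamma> :: "('w \<times> 'c::complex_inner) set"
  assumes \<Gamma>: "\<Gamma> \<in> orthonormal_bases q" and z: "cmod z = 1"
  shows "dilation z ` \<Gamma> \<in> orthonormal_bases q"
proof -
  have inv: "dilation z (dilation (inverse z) h) = h" "dilation (inverse z) (dilation z h) = h"
    for h :: "'w \<times> 'c"
  proof -
    have "z \<noteq> 0" using z by auto
    then show "dilation z (dilation (inverse z) h) = h" "dilation (inverse z) (dilation z h) = h"
      by (simp_all add: dilation_def scaleC_scaleC power_inverse)
  qed
  have z': "cmod (inverse z) = 1" using z by (simp add: norm_inverse)
  have "\<exists>y\<in>cspan (dilation z ` \<Gamma>). g_norm q (x - y) < \<epsilon>" if x: "x \<in> g_CM q" and "\<epsilon> > 0" for x \<epsilon>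
  proof -
    have "dilation (inverse z) x \<in> g_CM q" by (rule dilation_in_g_CM[OF z' x])
    then obtain y where y: "y \<in> cspan \<Gamma>" "g_norm q (dilation (inverse z) x - y) < \<epsilon>"
      using \<Gamma> \<open>\<epsilon> > 0\<close> unfolding orthonormal_bases_def by blast
    have "module_hom scaleC scaleC (dilation z :: 'w \<times> 'c \<Rightarrow> 'w \<times> 'c)"
      by (simp add: module_hom_iff module_scaleC dilation_add dilation_scaleC)
    then have "dilation z y \<in> cspan (dilation z ` \<Gamma>)"
      using y(1) by (simp add: module_hom.span_image)
    moreover have "x - dilation z y = dilation z (dilation (inverse z) x - y)"
      using dilation_add[of z "dilation (inverse z) x - y" y] by (simp add: inv algebra_simps)
    then have "g_norm q (x - dilation z y) < \<epsilon>"
      using y(2) by (simp add: g_norm_def g_inner_dilation[OF z])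
    ultimately show ?thesis by blast
  qed
  moreover have "dilation z ` \<Gamma> \<subseteq> g_CM q"
    using \<Gamma> unfolding orthonormal_bases_def by (blast intro: dilation_in_g_CM[OF z])
  moreover have "g_inner q x y = (if x = y then 1 else 0)"
    if "x \<in> dilation z ` \<Gamma>" "y \<in> dilation z ` \<Gamma>" for x y
  proof -
    obtain x' y' where *: "x = dilation z x'" "y = dilation z y'" "x' \<in> \<Gamma>" "y' \<in> \<Gamma>"
      using \<open>x \<in> _\<close> \<open>y \<in> _\<close> by blast
    then have "g_inner q x' y' = (if x' = y' then 1 else 0)"
      using \<Gamma> unfolding orthonormal_bases_def by blast
    moreover have "x = y \<longleftrightarrow> x' = y'" using inv(2) *(1,2) by metis
    ultimately show ?thesis by (simp add: *(1,2) g_inner_dilation[OF z])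
  qed
  ultimately show ?thesis by (simp add: orthonormal_bases_def)
qed

lemma inj_map_dilation:
  assumes "cmod z = 1"
  shows "inj (map (dilation z :: 'w \<times> 'c::complex_inner \<Rightarrow> _))"
proof (intro inj_mapI inj_on_inverseI[of _ "dilation (inverse z)"])
  fix h :: "'w \<times> 'c"
  have "z \<noteq> 0" using assms by auto
  then show "dilation (inverse z) (dilation z h) = h"
    by (simp add: dilation_def scaleC_scaleC power_inverse)
qed

end

section \<open>Norms of reweighted functionals\<close>

text \<open>Cauchy--Schwarz with the weight split as \<open>\<bar>\<kappa>\<bar> = \<surd>\<bar>\<kappa>\<bar> \<surd>\<bar>\<kappa>\<bar>\<close>. As a bound for squares it can be
  summed over an orthonormal basis term by term.\<close>
lemma norm_sum_mult_le:
  fixes \<kappa> a :: "nat \<Rightarrow> complex"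
  assumes "(\<Sum>j<M. cmod (\<kappa> j)) \<le> C"
  shows "(cmod (\<Sum>j<M. \<kappa> j * a j))\<^sup>2 \<le> (\<Sum>j<M. C * cmod (\<kappa> j) * (cmod (a j))\<^sup>2)"
proof -
  have "cmod (\<Sum>j<M. \<kappa> j * a j) \<le> (\<Sum>j<M. sqrt (cmod (\<kappa> j)) * (sqrt (cmod (\<kappa> j)) * cmod (a j)))"
    by (rule order.trans[OF norm_sum]) (simp add: norm_mult flip: mult.assoc)
  then have "(cmod (\<Sum>j<M. \<kappa> j * a j))\<^sup>2 \<le> (\<Sum>j<M. sqrt (cmod (\<kappa> j)) * (sqrt (cmod (\<kappa> j)) * cmod (a j)))\<^sup>2"
    by (intro power_mono) auto
  also have "\<dots> \<le> (\<Sum>j<M. (sqrt (cmod (\<kappa> j)))\<^sup>2) * (\<Sum>j<M. (sqrt (cmod (\<kappa> j)) * cmod (a j))\<^sup>2)"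
    by (rule Cauchy_Schwarz_ineq_sum)
  also have "\<dots> = (\<Sum>j<M. cmod (\<kappa> j)) * (\<Sum>j<M. cmod (\<kappa> j) * (cmod (a j))\<^sup>2)"
    by (simp add: power_mult_distrib)
  also have "\<dots> \<le> C * (\<Sum>j<M. cmod (\<kappa> j) * (cmod (a j))\<^sup>2)"
    using assms by (intro mult_right_mono sum_nonneg) auto
  finally show ?thesis by (simp add: sum_distrib_left mult.assoc)
qed

context complex_abstract_wiener_space
begin

lemma finite_sum_le_degree_sqnorm:
  assumes \<Gamma>: "\<Gamma> \<in> orthonormal_bases q" and F: "finite F" "F \<subseteq> {hs \<in> lists \<Gamma>. length hs = n}"
    and z: "cmod z = 1"
  shows "(\<Sum>hs\<in>F. ennreal ((cmod (\<alpha> (tensor (g_CM q) (map (dilation z) hs))))\<^sup>2)) \<le> degree_sqnorm q n \<alpha>"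
proof -
  let ?F = "map (dilation z) ` F"
  have "(\<Sum>hs\<in>F. ennreal ((cmod (\<alpha> (tensor (g_CM q) (map (dilation z) hs))))\<^sup>2)) =
      (\<Sum>hs\<in>?F. ennreal ((cmod (\<alpha> (tensor (g_CM q) hs)))\<^sup>2))"
    by (subst sum.reindex) (auto intro: inj_on_subset[OF inj_map_dilation[OF z]])
  also have "\<dots> \<le> basis_sqnorm (g_CM q) (dilation z ` \<Gamma>) n \<alpha>"
    unfolding basis_sqnorm_def nonneg_infsum_complete[OF zero_le]
  proof (rule SUP_upper)
    show "?F \<in> {F. finite F \<and> F \<subseteq> {hs \<in> lists (dilation z ` \<Gamma>). length hs = n}}"
      using F by (fastforce simp: in_lists_conv_set)
  qed
  also have "\<dots> \<le> degree_sqnorm q n \<alpha>"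
    unfolding degree_sqnorm_def by (rule SUP_upper[OF orthonormal_bases_dilation[OF \<Gamma> z]])
  finally show ?thesis .
qed

text \<open>It is enough to bound finite partial sums. Each dilate of
  \<open>\<alpha>\<close>, summed over words in \<open>\<Gamma>\<close>, is \<open>\<alpha>\<close> summed over words in the dilated basis.\<close>
lemma degree_sqnorm_average_le:
  fixes \<alpha> \<gamma> :: "(('w \<times> 'c::complex_inner) list \<Rightarrow>\<^sub>0 complex) set \<Rightarrow> complex"
  assumes avg: "\<And>hs. hs \<in> lists (g_CM q) \<Longrightarrow> length hs = n \<Longrightarrow>
      \<gamma> (tensor (g_CM q) hs) = (\<Sum>j<M. \<kappa> j * \<alpha> (tensor (g_CM q) (map (dilation (z j)) hs)))"
    and z: "\<And>j. j < M \<Longrightarrow> cmod (z j) = 1" and C: "(\<Sum>j<(M::nat). cmod (\<kappa> j)) \<le> C"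
  shows "degree_sqnorm q n \<gamma> \<le> ennreal (C\<^sup>2) * degree_sqnorm q n \<alpha>"
  unfolding degree_sqnorm_def[of _ _ \<gamma>]
proof (rule SUP_least)
  fix \<Gamma> :: "('w \<times> 'c) set" assume \<Gamma>: "\<Gamma> \<in> orthonormal_bases q"
  then have sub: "\<Gamma> \<subseteq> g_CM q" by (simp add: orthonormal_bases_def)
  let ?D = "degree_sqnorm q n \<alpha>"
  let ?a = "\<lambda>j hs. cmod (\<alpha> (tensor (g_CM q) (map (dilation (z j)) hs)))"
  have C0: "0 \<le> C" by (rule order.trans[OF _ C]) (simp add: sum_nonneg)
  show "basis_sqnorm (g_CM q) \<Gamma> n \<gamma> \<le> ennreal (C\<^sup>2) * ?D"
    unfolding basis_sqnorm_def nonneg_infsum_complete[OF zero_le]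
  proof (rule SUP_least, clarify)
    fix F assume F: "finite F" "F \<subseteq> {hs \<in> lists \<Gamma>. length hs = n}"
    have "(\<Sum>hs\<in>F. ennreal ((cmod (\<gamma> (tensor (g_CM q) hs)))\<^sup>2)) \<le>
        (\<Sum>hs\<in>F. \<Sum>j<M. ennreal (C * cmod (\<kappa> j)) * ennreal ((?a j hs)\<^sup>2))"
    proof (rule sum_mono)
      fix hs assume "hs \<in> F"
      then have "hs \<in> lists (g_CM q)" "length hs = n" using F(2) lists_mono[OF sub] by blast+
      then have "(cmod (\<gamma> (tensor (g_CM q) hs)))\<^sup>2 \<le> (\<Sum>j<M. C * cmod (\<kappa> j) * (?a j hs)\<^sup>2)"
        using norm_sum_mult_le[OF C] by (simp add: avg)
      then have "ennreal ((cmod (\<gamma> (tensor (g_CM q) hs)))\<^sup>2) \<le> ennreal (\<Sum>j<M. C * cmod (\<kappa> j) * (?a j hs)\<^sup>2)"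
        by (rule ennreal_leI)
      also have "\<dots> = (\<Sum>j<M. ennreal (C * cmod (\<kappa> j)) * ennreal ((?a j hs)\<^sup>2))"
        using C0 by (simp add: ennreal_mult sum_ennreal[symmetric])
      finally show "ennreal ((cmod (\<gamma> (tensor (g_CM q) hs)))\<^sup>2) \<le>
        (\<Sum>j<M. ennreal (C * cmod (\<kappa> j)) * ennreal ((?a j hs)\<^sup>2))" .
    qed
    also have "\<dots> = (\<Sum>j<M. ennreal (C * cmod (\<kappa> j)) * (\<Sum>hs\<in>F. ennreal ((?a j hs)\<^sup>2)))"
      by (subst sum.swap) (simp only: sum_distrib_left)
    also have "\<dots> \<le> (\<Sum>j<M. ennreal (C * cmod (\<kappa> j)) * ?D)"
      using finite_sum_le_degree_sqnorm[OF \<Gamma> F z] by (intro sum_mono mult_left_mono) auto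
    also have "\<dots> = ennreal (C * (\<Sum>j<M. cmod (\<kappa> j))) * ?D"
      using C0 by (simp add: sum_distrib_left flip: sum_distrib_right)
    also have "\<dots> \<le> ennreal (C\<^sup>2) * ?D"
      using C C0 by (intro mult_right_mono ennreal_leI) (auto simp: power2_eq_square intro: mult_left_mono)
    finally show "(\<Sum>hs\<in>F. ennreal ((cmod (\<gamma> (tensor (g_CM q) hs)))\<^sup>2)) \<le> ennreal (C\<^sup>2) * ?D" .
  qed
qed

lemma degree_sqnorm_reweight_le:
  fixes \<alpha> \<gamma> :: "(('w \<times> 'c::complex_inner) list \<Rightarrow>\<^sub>0 complex) set \<Rightarrow> complex"
  assumes \<alpha>: "\<alpha> \<in> tensor_dual (g_CM q)" and c: "bounded_multiplier C (2 * n) c"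
    and \<gamma>: "\<And>hs. hs \<in> lists (g_CM q) \<Longrightarrow> length hs = n \<Longrightarrow> \<gamma> (tensor (g_CM q) hs) =
      graded_functional.reweight (\<lambda>hs. \<alpha> (tensor (g_CM q) hs)) c hs"
  shows "degree_sqnorm q n \<gamma> \<le> ennreal (C\<^sup>2) * degree_sqnorm q n \<alpha>"
proof -
  let ?f = "\<lambda>hs. \<alpha> (tensor (g_CM q) hs)"
  interpret graded_functional "cm_space q" ?f
    using multilinear_on_tensor_dual[OF \<alpha>]
    by unfold_locales (simp_all add: zero_in_cm_space scaleC_in_cm_space g_CM_def)
  obtain M :: nat and \<kappa> z where *: "\<And>j. j < M \<Longrightarrow> cmod (z j) = 1"
      "\<And>m. m \<le> 2 * n \<Longrightarrow> c m = (\<Sum>j<M. \<kappa> j * z j ^ m)" "(\<Sum>j<M. cmod (\<kappa> j)) \<le> C"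
    using c unfolding bounded_multiplier_def by blast
  show ?thesis
  proof (rule degree_sqnorm_average_le[OF _ *(1) *(3)])
    fix hs :: "('w \<times> 'c) list" assume hs: "hs \<in> lists (g_CM q)" "length hs = n"
    then show "\<gamma> (tensor (g_CM q) hs) = (\<Sum>j<M. \<kappa> j * ?f (map (dilation (z j)) hs))"
      using reweight_average[of hs M z c \<kappa>] * by (simp add: \<gamma>) (simp add: g_CM_def)
  qed
qed

end

section \<open>Density of the finite rank tensors\<close>

lemma ennreal_suminf_tail_less:
  fixes a :: "nat \<Rightarrow> ennreal"
  assumes "suminf a < \<infinity>" "e > 0"
  shows "\<exists>N. suminf (\<lambda>n. a (n + N)) < ennreal e"
proof -
  have fin: "a n < \<infinity>" for n
    using assms(1) ennreal_suminf_lessD by blast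
  define b where "b n = enn2real (a n)" for n
  have a: "a n = ennreal (b n)" for n using fin[of n] by (simp add: b_def)
  have "summable b"
    using assms(1) by (intro summable_suminf_not_top) (auto simp: b_def simp flip: a[unfolded b_def])
  obtain N where N: "\<And>n. n \<ge> N \<Longrightarrow> norm (suminf (\<lambda>i. b (i + n))) < e"
    using suminf_exist_split[OF assms(2) \<open>summable b\<close>] by blast
  have "suminf (\<lambda>n. a (n + N)) = ennreal (suminf (\<lambda>n. b (n + N)))"
    unfolding a using summable_ignore_initial_segment[OF \<open>summable b\<close>]
    by (intro suminf_ennreal2) (auto simp: b_def)
  also have "\<dots> < ennreal e" using N[of N] assms(2) by (intro ennreal_lessI) auto
  finally show ?thesis by blast
qed

theorem lemma7p3:
  fixes \<mu> :: "'w::{complex_banach, second_countable_topology} measure"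
    and q :: "('w \<Rightarrow>\<^sub>L real) \<Rightarrow> ('w \<Rightarrow>\<^sub>L real) \<Rightarrow> real"
    and \<omega> :: "'w \<Rightarrow> 'w \<Rightarrow> 'c::complex_inner"
    and T :: real
  assumes "complex_abstract_wiener_space \<mu> q"
    and "\<exists>B :: 'c set. finite B \<and> cspan B = UNIV"
    and "continuous_skew_form \<omega>"
    and "T > 0"
  shows "\<forall>\<alpha>\<in>J0_T q \<omega> T. \<forall>\<epsilon>>0. \<exists>\<beta>\<in>J0_T q \<omega> T.
           finite_rank (g_CM q) \<beta> \<and> J0_sqnorm q T (\<lambda>x. \<alpha> x - \<beta> x) < ennreal (\<epsilon>\<^sup>2)"
proof (intro ballI allI impI)
  fix \<alpha> :: "(('w \<times> 'c) list \<Rightarrow>\<^sub>0 complex) set \<Rightarrow> complex" and \<epsilon> :: real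
  assume \<alpha>: "\<alpha> \<in> J0_T q \<omega> T" and \<epsilon>: "\<epsilon> > 0"
  interpret complex_abstract_wiener_space \<mu> q by fact
  let ?V = "g_CM q :: ('w \<times> 'c) set"
  define f where "f hs = \<alpha> (tensor ?V hs)" for hs
  have \<alpha>_ann: "\<alpha> \<in> J_annihilator ?V (g_bracket \<omega>)" and fin: "J0_sqnorm q T \<alpha> < \<infinity>"
    using \<alpha> by (auto simp: J0_T_def)
  then have \<alpha>_dual: "\<alpha> \<in> tensor_dual ?V" by (simp add: J_annihilator_def)
  have br_mem: "g_bracket \<omega> h k \<in> ?V" for h k
    by (simp add: g_bracket_def g_CM_def zero_in_cm_space)
  have \<omega>_scaleC: "\<omega> (c *\<^sub>C x) y = c *\<^sub>C \<omega> x y" "\<omega> x (c *\<^sub>C y) = c *\<^sub>C \<omega> x y" for c x y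
    using assms(3) unfolding continuous_skew_form_def by blast+
  have br_dilation: "g_bracket \<omega> (dilation z h) (dilation z k) = dilation z (g_bracket \<omega> h k)" for z h k
    using \<omega>_scaleC
    by (simp add: g_bracket_def dilation_def scaleC_scaleC power2_eq_square)
  interpret graded_functional "cm_space q" f
    using multilinear_on_tensor_dual[OF \<alpha>_dual]
    by unfold_locales (simp_all add: zero_in_cm_space scaleC_in_cm_space g_CM_def f_def[abs_def])

  define a where "a n = ennreal (T ^ n / fact n) * degree_sqnorm q n \<alpha>" for n
  have a_fin: "suminf a < \<infinity>" using fin by (simp add: J0_sqnorm_def a_def[abs_def])
  obtain N where N: "suminf (\<lambda>n. a (n + N)) < ennreal (\<epsilon>\<^sup>2 / 16)"
    using ennreal_suminf_tail_less[OF a_fin, of "\<epsilon>\<^sup>2 / 16"] \<epsilon> by auto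
  \<comment> \<open>Degrees \<open>n < N\<close> only have weights \<open>m \<le> 2 n < K\<close>, where the multiplier is \<open>1\<close>;
    the summand \<open>1\<close> keeps \<open>K\<close> positive.\<close>
  define K where "K = 2 * N + 1"
  define c where "c = vallee_poussin K"
  define \<beta> where "\<beta> = tensor_functional ?V (reweight c)"
  have ml: "multilinear_on ?V (reweight c)"
    using multilinear_reweight[of c] by (simp add: g_CM_def)
  have \<beta>_tensor: "\<beta> (tensor ?V hs) = reweight c hs" if "hs \<in> lists ?V" for hs
    unfolding \<beta>_def by (rule tensor_functional_tensor[OF ml that])
  have diff_tensor: "\<alpha> (tensor ?V hs) - \<beta> (tensor ?V hs) = reweight (\<lambda>m. 1 - c m) hs"
    if "hs \<in> lists ?V" for hs
    using reweight_complement[of hs c] that \<beta>_tensor[OF that] by (simp add: f_def g_CM_def)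

  have \<beta>_ann: "\<beta> \<in> J_annihilator ?V (g_bracket \<omega>)"
    unfolding \<beta>_def
  proof (rule tensor_functional_in_J_annihilator[OF br_mem ml])
    have "lie_compatible ?V (g_bracket \<omega>) f"
      using J_annihilator_lie_compatible[OF br_mem \<alpha>_ann] by (simp add: f_def[abs_def])
    then show "lie_compatible ?V (g_bracket \<omega>) (reweight c)"
      using lie_compatible_reweight[of "g_bracket \<omega>" c] br_mem br_dilation by (simp add: g_CM_def)
  qed

  have \<beta>_degree: "degree_sqnorm q n \<beta> \<le> ennreal 9 * degree_sqnorm q n \<alpha>" for n
    using degree_sqnorm_reweight_le[OF \<alpha>_dual, of 3 n c \<beta>]
      bounded_multiplier_vallee_poussin[of K "2 * n"] \<beta>_tensor
    by (simp add: c_def K_def f_def[abs_def])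
  have "J0_sqnorm q T \<beta> \<le> suminf (\<lambda>n. ennreal 9 * a n)"
    unfolding J0_sqnorm_def a_def
    by (intro suminf_le summableI) (metis \<beta>_degree mult.left_commute mult_left_mono zero_le)
  also have "\<dots> = ennreal 9 * suminf a" by (rule ennreal_suminf_cmult)
  also have "\<dots> < \<infinity>" using a_fin by (simp add: ennreal_mult_less_top)
  finally have \<beta>: "\<beta> \<in> J0_T q \<omega> T" using \<beta>_ann by (simp add: J0_T_def)

  have "finite_rank ?V \<beta>"
    unfolding finite_rank_def
  proof (rule finite_subset)
    show "{n. \<exists>x\<in>tensor_power ?V n. \<beta> x \<noteq> 0} \<subseteq> {..<2 * K}"
    proof (rule subsetI, rule ccontr)
      fix n assume "n \<in> {n. \<exists>x\<in>tensor_power ?V n. \<beta> x \<noteq> 0}" and n: "n \<notin> {..<2 * K}"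
      then obtain p where p: "Poly_Mapping.keys p \<subseteq> {hs \<in> lists ?V. length hs = n}"
          "\<beta> (tensor_class ?V p) \<noteq> 0"
        by (auto simp: tensor_power_def)
      have "\<beta> (tensor_class ?V p) = word_eval (reweight c) p"
        unfolding \<beta>_def by (rule tensor_functional_class[OF ml]) (use p(1) in \<open>auto simp: free_algebra_def\<close>)
      also have "\<dots> = 0"
      proof (rule word_eval_eq_0)
        fix hs assume "hs \<in> Poly_Mapping.keys p"
        then have "hs \<in> lists ?V" "length hs = n" using p(1) by auto
        then show "reweight c hs = 0"
          using n by (intro reweight_eq_0) (auto simp: g_CM_def c_def vallee_poussin_eq_0)
      qed
      finally show False using p(2) by simp
    qed
  qed simp

  moreover have "J0_sqnorm q T (\<lambda>x. \<alpha> x - \<beta> x) < ennreal (\<epsilon>\<^sup>2)"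
  proof -
    let ?\<gamma> = "\<lambda>x. \<alpha> x - \<beta> x"
    let ?t = "\<lambda>n. ennreal (T ^ n / fact n) * degree_sqnorm q n ?\<gamma>"
    have low: "?t n = 0" if "n < N" for n
    proof -
      \<comment> \<open>The multiplier vanishes up to weight \<open>2 n\<close>, so the empty average represents it.\<close>
      have "bounded_multiplier 0 (2 * n) (\<lambda>m. 1 - c m)"
        unfolding bounded_multiplier_def
        by (rule exI[of _ 0]) (use that in \<open>simp add: c_def K_def vallee_poussin_eq_1\<close>)
      from degree_sqnorm_reweight_le[OF \<alpha>_dual this, of ?\<gamma>] show ?thesis
        using diff_tensor by (simp add: f_def[abs_def])
    qed
    have high: "?t n \<le> ennreal 16 * a n" for n
    proof -
      have "bounded_multiplier 4 (2 * n) (\<lambda>m. 1 - c m)"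
        using bounded_multiplier_complement[OF bounded_multiplier_vallee_poussin[of K "2 * n"]]
        by (simp add: c_def K_def)
      from degree_sqnorm_reweight_le[OF \<alpha>_dual this, of ?\<gamma>]
      have "degree_sqnorm q n ?\<gamma> \<le> ennreal 16 * degree_sqnorm q n \<alpha>"
        using diff_tensor by (simp add: f_def[abs_def])
      then show ?thesis unfolding a_def by (metis mult.left_commute mult_left_mono zero_le)
    qed
    have "J0_sqnorm q T ?\<gamma> = suminf (\<lambda>n. ?t (n + N)) + (\<Sum>n<N. ?t n)"
      unfolding J0_sqnorm_def by (rule suminf_offset) simp
    also have "\<dots> = suminf (\<lambda>n. ?t (n + N))" using low by simp
    also have "\<dots> \<le> suminf (\<lambda>n. ennreal 16 * a (n + N))" by (intro suminf_le summableI high)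
    also have "\<dots> = ennreal 16 * suminf (\<lambda>n. a (n + N))" by (rule ennreal_suminf_cmult)
    also have "\<dots> < ennreal 16 * ennreal (\<epsilon>\<^sup>2 / 16)"
      using N by (intro ennreal_mult_strict_left_mono) auto
    also have "\<dots> = ennreal (\<epsilon>\<^sup>2)" by (subst ennreal_mult[symmetric]) auto
    finally show ?thesis .
  qed
  ultimately show "\<exists>\<beta>\<in>J0_T q \<omega> T. finite_rank ?V \<beta> \<and> J0_sqnorm q T (\<lambda>x. \<alpha> x - \<beta> x) < ennreal (\<epsilon>\<^sup>2)"
    using \<beta> by blast
qed

end
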